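(* Let $0\le f\in L^1[-\pi,\pi]$ (not a.e. zero) and let $f^\#$ be its symmetric decreasing rearrangement. Then \[\int_{-\pi}^{\pi}\phi\bigl(u_f(x)\bigr)\,dx\le\int_{-\pi}^{\pi}\phi\bigl(u_{f^\#}(x)\bigr)\,dx\] for every convex and increasing $\phi:\mathbb{R}\to\mathbb{R}$; equivalently $u_f^\star(t)\le u_{f^\#}^\star(t)$ for all $t\in[0,2\pi]$. Furthermore, if $\phi$ is strictly increasing (and convex), equality holds if and only if $f=f^\#$ a.e. on $(-\pi,\pi)$.
   Context: $\lambda$ is Lebesgue measure. $G(x,y)=-\frac{xy}{2\pi}-\frac12|x-y|+\frac{\pi}{2}$ on $[-\pi,\pi]^2$, $u_g(x)=\int_{-\pi}^\pi G(x,y)g(y)\,dy$ (solution of $-u''=g$ on $(-\pi,\pi)$, $u(\pm\pi)=0$). Decreasing rearrangement: $f^*(t)=\inf\{s:\lambda(\{x\in[-\pi,\pi]:f(x)>s\})\le t\}$ for $t\in(0,2\pi)$, $f^*(0)=\operatorname{ess\,sup}f$, $f^*(2\pi)=\operatorname{ess\,inf}f$; $f^\#(t)=f^*(2|t|)$ on $[-\pi,\pi]$. Star function: $g^\star(t)=\sup\{\int_E g\,d\lambda:E\subset[-\pi,\pi]\text{ Borel},\lambda(E)=t\}$. *)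

theory Defs
  imports "HOL-Analysis.Analysis" "HOL-Probability.Essential_Supremum"
begin

text \<open>Green's function of -u'' = g on (-pi,pi) with Dirichlet conditions.\<close>
definition G :: "real \<Rightarrow> real \<Rightarrow> real" where
  "G x y = - (x * y) / (2 * pi) - \<bar>x - y\<bar> / 2 + pi / 2"

definition u :: "(real \<Rightarrow> real) \<Rightarrow> real \<Rightarrow> real" where
  "u g x = (LINT y:{-pi..pi}|lebesgue. G x y * g y)"

definition ess_sup_on :: "(real \<Rightarrow> real) \<Rightarrow> ereal" where
  "ess_sup_on f = esssup (restrict_space lebesgue {-pi..pi}) (\<lambda>x. ereal (f x))"

definition ess_inf_on :: "(real \<Rightarrow> real) \<Rightarrow> ereal" where
  "ess_inf_on f = - esssup (restrict_space lebesgue {-pi..pi}) (\<lambda>x. - ereal (f x))"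

definition decr_rearr :: "(real \<Rightarrow> real) \<Rightarrow> real \<Rightarrow> real" where
  "decr_rearr f t =
     (if t \<le> 0 then real_of_ereal (ess_sup_on f)
      else if t \<ge> 2 * pi then real_of_ereal (ess_inf_on f)
      else Inf {s. measure lebesgue {x \<in> {-pi..pi}. f x > s} \<le> t})"

definition sym_rearr :: "(real \<Rightarrow> real) \<Rightarrow> real \<Rightarrow> real" where
  "sym_rearr f t = decr_rearr f (2 * \<bar>t\<bar>)"

definition star_fun :: "(real \<Rightarrow> real) \<Rightarrow> real \<Rightarrow> real" where
  "star_fun g t = Sup {(LINT x:E|lebesgue. g x) | E.
       E \<in> sets borel \<and> E \<subseteq> {-pi..pi} \<and> measure lebesgue E = t}"

end

theory Submission
  imports Defs
begin

text \<open>
  The comparison is pointwise. Let \<open>-pi \<le> a \<le> b \<le> pi\<close>, \<open>p = pi + a\<close>, \<open>q = pi - b\<close> and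
  \<open>r = (b - a) / 2\<close>. The function \<open>(q G(a, \<sqdot>) + p G(b, \<sqdot>)) / (p + q)\<close> is a trapezoid, and its
  symmetric rearrangement is \<open>\<kappa> = 4 p q / (p + q)\<^sup>2 \<le> 1\<close> times the even trapezoid
  \<open>(G(r, \<sqdot>) + G(- r, \<sqdot>)) / 2\<close>. The Hardy-Littlewood inequality therefore gives
  \<open>min (u f a) (u f b) \<le> \<kappa> v(r)\<close> with \<open>v = u (sym_rearr f)\<close>. Hence every superlevel set of \<open>u f\<close>
  is at most as long as the corresponding one of \<open>v\<close>, which yields both comparisons by the layer
  cake formula.

  If the integrals agree for a strictly increasing function, then \<open>\<kappa> = 1\<close>, that is \<open>a = - b\<close>, for the
  endpoints of almost every superlevel set. So \<open>u f\<close> equals \<open>v\<close>, and differentiating \<open>u f = v\<close>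
  recovers \<open>f\<close>.
\<close>

section \<open>Layer cake and concentration\<close>

text \<open>The weights are chosen so that slopes cancel: between \<open>a\<close> and
  \<open>b\<close> the function \<open>G a\<close> has slope \<open>- p / (2 * pi)\<close> and
  \<open>G b\<close> has slope \<open>q / (2 * pi)\<close>. The resulting trapezoid has base
  \<open>2 * pi\<close>, top \<open>b - a\<close> and height \<open>p * q / (p + q)\<close>; the
  even one has the same base and top, and height \<open>(p + q) / 4\<close>. The ratio of the
  heights is \<open>\<kappa>\<close>. A minimum over two points enters because it lies below every
  weighted mean, which is linear in \<open>f\<close> and so accessible to rearrangement, while two
  points of a common superlevel set bound it from below. Lengths of superlevel sets are thus
  compared without locating their end points. In the equality case end points are needed, since
  equal integrals give no information at a given point. The function \<open>u_rearr\<close> is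
  therefore put between \<open>u f\<close> and \<open>v\<close>: it is a supremum that is attained,
  and the inequality must be sharp at a maximising pair. There \<open>\<kappa> = 1\<close> follows
  by cancelling a value of \<open>v\<close>, which is positive because \<open>f\<close> is not
  almost everywhere zero.\<close>

lemma sigma_finite_lebesgue: "sigma_finite_measure (lebesgue :: real measure)"
proof
  obtain A :: "real set set" where A: "countable A" "A \<subseteq> sets lborel" "\<Union>A = space lborel"
    "\<forall>a\<in>A. emeasure lborel a \<noteq> \<infinity>"
    using lborel.sigma_finite_countable by blast
  then show "\<exists>A::real set set. countable A \<and> A \<subseteq> sets lebesgue \<and> \<Union>A = space lebesgue \<and>
      (\<forall>a\<in>A. emeasure lebesgue a \<noteq> \<infinity>)"
    by (intro exI[of _ A]) (auto simp: subset_eq)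
qed

text \<open>The space variable carries the completed measure of the statement, the layer variable
  \<open>s\<close> only the Borel one; Fubini is used for this mixed product.\<close>

interpretation lebesgue_lborel: pair_sigma_finite "lebesgue :: real measure" "lborel :: real measure"
  unfolding pair_sigma_finite_def using sigma_finite_lebesgue lborel.sigma_finite_measure_axioms
  by blast

text \<open>\<open>ennreal (f x)\<close> is the length of \<open>{0..<f x}\<close>, also for
  negative \<open>f x\<close>, which \<open>ennreal\<close> sends to 0. Exchanging the integrals
  gives the formula.\<close>

lemma layer_cake:
  fixes f :: "real \<Rightarrow> real" and k :: "real \<Rightarrow> ennreal"
  assumes [measurable]: "f \<in> borel_measurable lebesgue" "k \<in> borel_measurable lebesgue"
  shows "(\<integral>\<^sup>+x. k x * ennreal (f x) \<partial>lebesgue)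
    = (\<integral>\<^sup>+s. indicator {0..} s * (\<integral>\<^sup>+x. k x * indicator {x. s < f x} x \<partial>lebesgue) \<partial>lborel)"
proof -
  have eq: "ennreal (f x) = (\<integral>\<^sup>+s. indicator {0..<f x} s \<partial>lborel)" for x
    by (cases "0 \<le> f x") (auto simp: ennreal_neg)
  have "(\<integral>\<^sup>+x. k x * ennreal (f x) \<partial>lebesgue)
      = (\<integral>\<^sup>+x. (\<integral>\<^sup>+s. k x * (indicator {0..} s * indicator {x. s < f x} x) \<partial>lborel) \<partial>lebesgue)"
    unfolding eq by (subst nn_integral_cmult[symmetric])
      (auto intro!: nn_integral_cong simp: indicator_def)
  also have "\<dots> = (\<integral>\<^sup>+s. (\<integral>\<^sup>+x. k x * (indicator {0..} s * indicator {x. s < f x} x) \<partial>lebesgue) \<partial>lborel)"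
    by (rule lebesgue_lborel.Fubini'[symmetric]) measurable
  also have "\<dots> = (\<integral>\<^sup>+s. indicator {0..} s * (\<integral>\<^sup>+x. k x * indicator {x. s < f x} x \<partial>lebesgue) \<partial>lborel)"
    by (intro nn_integral_cong) (simp add: indicator_def)
  finally show ?thesis .
qed

text \<open>The hypothesis on \<open>U\<close> and \<open>V\<close> says that two points of a superlevel set of \<open>U\<close> are
  never further apart than the length of the corresponding superlevel set of \<open>V\<close>.\<close>
lemma nn_integral_le_centred_interval:
  fixes U V :: "real \<Rightarrow> real"
  assumes [measurable]: "U \<in> borel_measurable lebesgue" "V \<in> borel_measurable lebesgue"
    "E \<in> sets lebesgue"
    and E: "E \<subseteq> {-c..c}" "emeasure lebesgue E \<le> ennreal (2 * \<rho>)" and \<rho>: "0 \<le> \<rho>" "\<rho> \<le> c"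
    and UV: "\<And>x y. \<lbrakk>-c \<le> x; x \<le> y; y \<le> c\<rbrakk> \<Longrightarrow> min (U x) (U y) \<le> V ((y - x) / 2)"
    and V: "\<And>x y. \<lbrakk>\<bar>x\<bar> \<le> \<bar>y\<bar>; \<bar>y\<bar> \<le> c\<rbrakk> \<Longrightarrow> V y \<le> V x"
  shows "(\<integral>\<^sup>+x. indicator E x * ennreal (U x) \<partial>lebesgue)
       \<le> (\<integral>\<^sup>+x. indicator {-\<rho><..<\<rho>} x * ennreal (V x) \<partial>lebesgue)"
proof -
  \<comment> \<open>By the layer cake formula it is enough to compare the superlevel sets for each
    \<open>s\<close>.\<close>
  have level: "emeasure lebesgue {x\<in>E. s < U x} \<le> emeasure lebesgue {x\<in>{-\<rho><..<\<rho>}. s < V x}" for s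
  proof (cases "{x\<in>E. s < U x} = {}")
    case False
    define A where "A = {x\<in>E. s < U x}"
    define B where "B = {x\<in>{-\<rho><..<\<rho>}. s < V x}"
    have [measurable]: "{-\<rho><..<\<rho>} \<in> sets lebesgue" by simp
    have [measurable]: "A \<in> sets lebesgue" "B \<in> sets lebesgue"
      unfolding A_def B_def by measurable
    have AE: "A \<subseteq> E" "A \<subseteq> {-c..c}" using E by (auto simp: A_def)
    have bdd: "bdd_above A" "bdd_below A" and ne: "A \<noteq> {}"
      using AE False by (auto intro: bdd_above_mono bdd_below_mono simp: A_def)
    have "emeasure lebesgue B \<le> emeasure lebesgue {-\<rho>..\<rho>}"
      by (intro emeasure_mono) (auto simp: B_def)
    also have "\<dots> < \<infinity>" using \<rho> by simp
    finally have fin: "emeasure lebesgue B = ennreal (measure lebesgue B)"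
      by (simp add: emeasure_eq_ennreal_measure)
    \<comment> \<open>Two points at distance \<open>y - x\<close> put \<open>(y - x) / 2\<close>
      into the superlevel set of \<open>V\<close>, which by monotonicity contains the whole centred
      interval up to there; \<open>m\<close> cuts it off at the window.\<close>
    have inner: "min (2 * \<rho>) (y - x) \<le> measure lebesgue B" if "x \<in> A" "y \<in> A" "x \<le> y" for x y
    proof -
      define m where "m = min \<rho> ((y - x) / 2)"
      have bd: "-c \<le> x" "y \<le> c" and U: "s < U x" "s < U y"
        using that AE by (auto simp: A_def subset_eq)
      have Vm: "s < V ((y - x) / 2)" using UV[OF bd(1) that(3) bd(2)] U by linarith
      have "s < V z" if "-m < z" "z < m" for z
      proof -
        have "m \<le> (y - x) / 2" unfolding m_def by (rule min.cobounded2)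
        then have "\<bar>z\<bar> \<le> \<bar>(y - x) / 2\<bar>" using that by linarith
        moreover have "\<bar>(y - x) / 2\<bar> \<le> c" using bd \<open>x \<le> y\<close> by auto
        ultimately show ?thesis using V[of z "(y - x) / 2"] Vm by linarith
      qed
      then have sub: "{-m<..<m} \<subseteq> B" by (auto simp: B_def m_def)
      have m: "0 \<le> m" using \<rho> that by (auto simp: m_def)
      have "ennreal (2 * m) = emeasure lebesgue {-m<..<m}" using m by simp
      also have "\<dots> \<le> emeasure lebesgue B" by (intro emeasure_mono sub) simp
      finally have "2 * m \<le> measure lebesgue B" using fin by (simp add: ennreal_le_iff)
      then show ?thesis by (auto simp: m_def min_def split: if_splits)
    qed
    \<comment> \<open>The extremes of \<open>A\<close> need not belong to \<open>A\<close>. Points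
      within \<open>\<epsilon>\<close>, half of the excess, of both extremes are still too far apart
      for \<open>inner\<close>.\<close>
    have outer: "min (2 * \<rho>) (Sup A - Inf A) \<le> measure lebesgue B"
    proof (rule ccontr)
      assume neg: "\<not> ?thesis"
      define \<epsilon> where "\<epsilon> = (Sup A - Inf A - measure lebesgue B) / 2"
      have "0 < \<epsilon>" using neg by (auto simp: \<epsilon>_def)
      then obtain x y where xy: "x \<in> A" "y \<in> A" "x < Inf A + \<epsilon>" "Sup A - \<epsilon> < y"
        using cInf_lessD[OF ne, of "Inf A + \<epsilon>"] less_cSupD[OF ne, of "Sup A - \<epsilon>"] by auto
      then have "measure lebesgue B < y - x" by (auto simp: \<epsilon>_def field_simps)
      moreover from this have "x \<le> y" using measure_nonneg[of lebesgue B] by linarith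
      ultimately show False using inner[OF xy(1,2)] neg by auto
    qed
    have "A \<subseteq> {Inf A..Sup A}" using bdd by (auto intro: cInf_lower cSup_upper)
    then have "emeasure lebesgue A \<le> emeasure lebesgue {Inf A..Sup A}"
      by (intro emeasure_mono) auto
    also have "\<dots> = ennreal (Sup A - Inf A)" using bdd ne by (simp add: cInf_le_cSup)
    finally have 1: "emeasure lebesgue A \<le> ennreal (Sup A - Inf A)" .
    have 2: "emeasure lebesgue A \<le> ennreal (2 * \<rho>)"
      using emeasure_mono[OF AE(1), of lebesgue] E(2) assms(3) by (meson order.trans)
    have "emeasure lebesgue A \<le> ennreal (min (2 * \<rho>) (Sup A - Inf A))"
      using 1 2 by (simp add: min_def)
    also have "\<dots> \<le> emeasure lebesgue B" unfolding fin by (rule ennreal_leI[OF outer])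
    finally show ?thesis by (simp add: A_def B_def)
  next
    case True
    then show ?thesis unfolding True by simp
  qed
  have ind: "(\<integral>\<^sup>+x. indicator S x * indicator {x. s < W x} x \<partial>lebesgue) = emeasure lebesgue {x\<in>S. s < W x}"
    if [measurable]: "S \<in> sets lebesgue" "W \<in> borel_measurable lebesgue" for S :: "real set" and W :: "real \<Rightarrow> real" and s
  proof -
    have "(\<integral>\<^sup>+x. indicator S x * indicator {x. s < W x} x \<partial>lebesgue) = (\<integral>\<^sup>+x. indicator {x\<in>S. s < W x} x \<partial>lebesgue)"
      by (intro nn_integral_cong) (auto simp: indicator_def)
    also have "\<dots> = emeasure lebesgue {x\<in>S. s < W x}"
      by (rule nn_integral_indicator) measurable
    finally show ?thesis .
  qed
  have I [measurable]: "{-\<rho><..<\<rho>} \<in> sets lebesgue" by simp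
  have mI: "indicator E \<in> borel_measurable lebesgue" "indicator {-\<rho><..<\<rho>} \<in> borel_measurable lebesgue"
    by measurable
  show ?thesis
    unfolding layer_cake[OF assms(1) mI(1)] layer_cake[OF assms(2) mI(2)]
      ind[OF assms(3,1)] ind[OF I assms(2)]
    by (intro nn_integral_mono mult_left_mono level) simp
qed

section \<open>Trapezoids built from the Green function\<close>

lemma G_eq:
  "G x y = (if x \<le> y then (pi + x) * (pi - y) / (2 * pi) else (pi - x) * (pi + y) / (2 * pi))"
  by (simp add: G_def field_simps abs_if)

text \<open>For fixed \<open>x\<close>, \<open>G\<close> is a tent in \<open>y\<close>, the minimum
  of its two linear branches; their difference is \<open>x - y\<close>, whose sign selects the
  smaller one.\<close>

lemma G_upper:
  assumes "-pi \<le> x" "x \<le> pi" "-pi \<le> y" "y \<le> pi"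
  shows "G x y \<le> (pi + x) * (pi - y) / (2 * pi)" "G x y \<le> (pi - x) * (pi + y) / (2 * pi)"
proof -
  have "(pi + x) * (pi - y) - (pi - x) * (pi + y) = 2 * pi * (x - y)"
    by (simp add: algebra_simps)
  then have "x \<le> y \<Longrightarrow> (pi + x) * (pi - y) \<le> (pi - x) * (pi + y)"
      "y \<le> x \<Longrightarrow> (pi - x) * (pi + y) \<le> (pi + x) * (pi - y)"
    by (smt (verit) mult_nonneg_nonneg mult_nonneg_nonpos pi_gt_zero)+
  then show "G x y \<le> (pi + x) * (pi - y) / (2 * pi)" "G x y \<le> (pi - x) * (pi + y) / (2 * pi)"
    unfolding G_eq by (auto intro!: divide_right_mono)
qed

lemma G_nonneg: "\<lbrakk>-pi \<le> x; x \<le> pi; -pi \<le> y; y \<le> pi\<rbrakk> \<Longrightarrow> 0 \<le> G x y"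
  unfolding G_eq by auto

lemma G_pos: "\<lbrakk>-pi < x; x < pi; -pi < y; y < pi\<rbrakk> \<Longrightarrow> 0 < G x y"
  unfolding G_eq by auto

text \<open>The products \<open>r * y\<close> cancel, and
  \<open>\<bar>r - y\<bar> + \<bar>r + y\<bar>\<close> is twice the maximum of
  \<open>\<bar>r\<bar>\<close> and \<open>\<bar>y\<bar>\<close>. The form as a minimum shows the
  flat top, the legs and the monotonicity in \<open>\<bar>y\<bar>\<close>.\<close>

lemma G_symmetric_average:
  "(G r y + G (-r) y) / 2 = min ((pi - \<bar>r\<bar>) / 2) ((pi - \<bar>y\<bar>) / 2)"
proof -
  have "G r y + G (-r) y = pi - (\<bar>r - y\<bar> + \<bar>r + y\<bar>) / 2"
    by (simp add: G_def abs_if add_divide_distrib)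
  then show ?thesis by (auto simp: min_def abs_if)
qed

text \<open>For the weights \<open>q / (p + q)\<close> and \<open>p / (p + q)\<close>, the combination of \<open>G a\<close> and \<open>G b\<close> is constant
  between \<open>a\<close> and \<open>b\<close>; its graph is a trapezoid whose symmetric rearrangement is a multiple, at
  most one, of the trapezoid of the preceding lemma.\<close>
lemma trapezoid_levels:
  fixes a b :: real
  defines "p \<equiv> pi + a" and "q \<equiv> pi - b"
  defines "K \<equiv> \<lambda>z. (q * G a z + p * G b z) / (p + q)"
  assumes ab: "-pi \<le> a" "a \<le> b" "b \<le> pi" "b - a < 2 * pi"
    and xy: "-pi \<le> x" "x \<le> y" "y \<le> pi"
  shows "min (K x) (K y)
    \<le> 4 * p * q / (p + q)\<^sup>2 * ((G ((b - a) / 2) ((y - x) / 2) + G (- ((b - a) / 2)) ((y - x) / 2)) / 2)"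
proof -
  have pq: "0 \<le> p" "0 \<le> q" "0 < p + q" using ab by (auto simp: p_def q_def)
  \<comment> \<open>The left leg, the right leg and the top of the trapezoid; each bound combines
    one branch of \<open>G a\<close> with one branch of \<open>G b\<close>.\<close>
  have lin: "K z \<le> q * (pi + z) / (p + q)" "K z \<le> p * (pi - z) / (p + q)" "K z \<le> p * q / (p + q)"
    if z: "-pi \<le> z" "z \<le> pi" for z
  proof -
    have Ga: "G a z \<le> p * (pi - z) / (2 * pi)" "G a z \<le> (2 * pi - p) * (pi + z) / (2 * pi)"
      using G_upper[of a z] ab z by (auto simp: p_def)
    have Gb: "G b z \<le> q * (pi + z) / (2 * pi)" "G b z \<le> (2 * pi - q) * (pi - z) / (2 * pi)"
      using G_upper[of b z] ab z by (auto simp: q_def)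
    have "q * G a z + p * G b z \<le> q * ((2 * pi - p) * (pi + z) / (2 * pi)) + p * (q * (pi + z) / (2 * pi))"
      using Ga Gb pq by (intro add_mono mult_left_mono)
    also have "\<dots> = q * (pi + z)" by (simp add: field_simps)
    finally show "K z \<le> q * (pi + z) / (p + q)" unfolding K_def using pq by (intro divide_right_mono) auto
    have "q * G a z + p * G b z \<le> q * (p * (pi - z) / (2 * pi)) + p * ((2 * pi - q) * (pi - z) / (2 * pi))"
      using Ga Gb pq by (intro add_mono mult_left_mono)
    also have "\<dots> = p * (pi - z)" by (simp add: field_simps)
    finally show "K z \<le> p * (pi - z) / (p + q)" unfolding K_def using pq by (intro divide_right_mono) auto
    have "q * G a z + p * G b z \<le> q * (p * (pi - z) / (2 * pi)) + p * (q * (pi + z) / (2 * pi))"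
      using Ga Gb pq by (intro add_mono mult_left_mono)
    also have "\<dots> = p * q" by (simp add: field_simps)
    finally show "K z \<le> p * q / (p + q)" unfolding K_def using pq by (intro divide_right_mono) auto
  qed
  define m where "m = min (K x) (K y)"
  have x: "m \<le> q * (pi + x) / (p + q)" and y: "m \<le> p * (pi - y) / (p + q)" and h: "m \<le> p * q / (p + q)"
    using lin[of x] lin[of y] xy by (auto simp: m_def)
  \<comment> \<open>Weighing the left leg at \<open>x\<close> by \<open>p\<close> and the right leg
    at \<open>y\<close> by \<open>q\<close> leaves an expression that depends on
    \<open>y - x\<close> only.\<close>
  have "m * (p + q) = m * p + m * q" by (simp add: algebra_simps)
  also have "\<dots> \<le> (q * (pi + x) / (p + q)) * p + (p * (pi - y) / (p + q)) * q"
    using x y pq by (intro add_mono mult_right_mono)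
  also have "\<dots> = p * q * (2 * pi - (y - x)) / (p + q)" by (simp add: add_divide_distrib[symmetric] algebra_simps)
  finally have "m \<le> p * q * (2 * pi - (y - x)) / (p + q) / (p + q)"
    using pq by (simp add: pos_le_divide_eq)
  also have "\<dots> = 4 * p * q / (p + q)\<^sup>2 * ((pi - \<bar>(y - x) / 2\<bar>) / 2)"
  proof -
    have "(pi - \<bar>(y - x) / 2\<bar>) / 2 = (2 * pi - (y - x)) / 4" using xy by (simp add: field_simps)
    then show ?thesis by (simp add: power2_eq_square)
  qed
  finally have 1: "m \<le> 4 * p * q / (p + q)\<^sup>2 * ((pi - \<bar>(y - x) / 2\<bar>) / 2)" .
  have "p * q / (p + q) = 4 * p * q / (p + q)\<^sup>2 * ((pi - \<bar>(b - a) / 2\<bar>) / 2)"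
  proof -
    have eq: "(pi - \<bar>(b - a) / 2\<bar>) / 2 = (p + q) / 4" using ab by (simp add: p_def q_def field_simps)
    have "4 * p * q / (p + q)\<^sup>2 * ((pi - \<bar>(b - a) / 2\<bar>) / 2) = p * q * (p + q) / ((p + q) * (p + q))"
      unfolding power2_eq_square eq by simp
    then show ?thesis using pq by simp
  qed
  with h 1 show ?thesis unfolding G_symmetric_average m_def[symmetric] by (auto simp: min_def)
qed

text \<open>The gap to 1 is \<open>((p - q) / (p + q))\<^sup>2\<close>. With
  \<open>p = pi + a\<close> and \<open>q = pi - b\<close> the equality case reads
  \<open>a = - b\<close>.\<close>

lemma four_mult_div_sum_squared:
  fixes p q :: real assumes "0 < p + q"
  shows "4 * p * q / (p + q)\<^sup>2 \<le> 1" "4 * p * q / (p + q)\<^sup>2 = 1 \<Longrightarrow> p = q"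
proof -
  have *: "(p + q)\<^sup>2 - 4 * p * q = (p - q)\<^sup>2" by (simp add: power2_eq_square algebra_simps)
  have pos: "0 < (p + q)\<^sup>2" using assms by simp
  have "0 \<le> (p - q)\<^sup>2" by simp
  then have "4 * p * q \<le> (p + q)\<^sup>2" using * by linarith
  then show "4 * p * q / (p + q)\<^sup>2 \<le> 1" using pos by simp
  assume "4 * p * q / (p + q)\<^sup>2 = 1"
  then have "4 * p * q = (p + q)\<^sup>2" using pos by (simp add: divide_eq_1_iff)
  with * show "p = q" by simp
qed


section \<open>The symmetric decreasing rearrangement\<close>

text \<open>The distribution function of \<open>f\<close>; for \<open>0 < t < 2 * pi\<close> the
  value \<open>decr_rearr f t\<close> depends on \<open>f\<close> only through it.\<close>

definition level :: "(real \<Rightarrow> real) \<Rightarrow> real \<Rightarrow> real" where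
  "level f s = measure lebesgue {x\<in>{-pi..pi}. s < f x}"

text \<open>Set integrability makes only the product of \<open>f\<close> with the indicator
  measurable, so the sets are read off from that product.\<close>

lemma superlevel_sets:
  fixes f :: "real \<Rightarrow> real"
  assumes "set_integrable lebesgue {-pi..pi} f"
  shows "{x\<in>{-pi..pi}. s < f x} \<in> sets lebesgue"
proof -
  have [measurable]: "(\<lambda>x. indicator {-pi..pi} x * f x) \<in> borel_measurable lebesgue"
    using borel_measurable_integrable[OF assms[unfolded set_integrable_def]] by simp
  have [measurable]: "{-pi..pi} \<in> sets lebesgue" by simp
  have "{x\<in>{-pi..pi}. s < indicator {-pi..pi} x * f x} \<in> sets lebesgue" by measurable
  also have "{x\<in>{-pi..pi}. s < indicator {-pi..pi} x * f x} = {x\<in>{-pi..pi}. s < f x}"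
    by (auto simp: indicator_def)
  finally show ?thesis .
qed

lemma emeasure_superlevel:
  assumes "set_integrable lebesgue {-pi..pi} f"
  shows "emeasure lebesgue {x\<in>{-pi..pi}. s < f x} = ennreal (level f s)"
proof -
  have "emeasure lebesgue {x\<in>{-pi..pi}. s < f x} \<le> emeasure lebesgue {-pi..pi}"
    by (intro emeasure_mono) auto
  also have "\<dots> < \<infinity>" by simp
  finally show ?thesis unfolding level_def by (intro emeasure_eq_ennreal_measure) simp
qed

lemma level_bounds:
  assumes "set_integrable lebesgue {-pi..pi} f"
  shows "0 \<le> level f s" "level f s \<le> 2 * pi"
proof -
  show "0 \<le> level f s" by (simp add: level_def)
  have "emeasure lebesgue {x\<in>{-pi..pi}. s < f x} \<le> emeasure lebesgue {-pi..pi}"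
    by (intro emeasure_mono) auto
  then show "level f s \<le> 2 * pi" unfolding emeasure_superlevel[OF assms] by (simp add: ennreal_le_iff)
qed

lemma level_antimono:
  assumes "set_integrable lebesgue {-pi..pi} f" "s \<le> s'"
  shows "level f s' \<le> level f s"
proof -
  have "emeasure lebesgue {x\<in>{-pi..pi}. s' < f x} \<le> emeasure lebesgue {x\<in>{-pi..pi}. s < f x}"
    using assms by (intro emeasure_mono superlevel_sets) auto
  then show ?thesis
    unfolding emeasure_superlevel[OF assms(1)] by (simp add: ennreal_le_iff level_bounds assms)
qed

lemma borel_measurable_level [measurable]:
  assumes "set_integrable lebesgue {-pi..pi} f"
  shows "level f \<in> borel_measurable borel"
proof -
  have "mono (\<lambda>s. - level f s)" using level_antimono[OF assms] by (auto simp: mono_def)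
  then have "(\<lambda>s. - level f s) \<in> borel_measurable borel" by (rule borel_measurable_mono)
  then show ?thesis by simp
qed

lemma level_negative:
  assumes "set_integrable lebesgue {-pi..pi} f"
    and "AE x in lebesgue. x \<in> {-pi..pi} \<longrightarrow> 0 \<le> f x" and "s < 0"
  shows "level f s = 2 * pi"
proof -
  have "level f s = measure lebesgue {-pi..pi}" unfolding level_def
  proof (rule measure_eq_AE)
    show "AE x in lebesgue. x \<in> {x\<in>{-pi..pi}. s < f x} \<longleftrightarrow> x \<in> {-pi..pi}"
      using assms(2) by eventually_elim (use assms(3) in auto)
  qed (use superlevel_sets[OF assms(1)] in simp_all)
  then show ?thesis by simp
qed

lemma nn_integral_layers:
  assumes f: "set_integrable lebesgue {-pi..pi} f"
    and [measurable]: "k \<in> borel_measurable lebesgue"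
  shows "(\<integral>\<^sup>+x. indicator {-pi..pi} x * k x * ennreal (f x) \<partial>lebesgue)
    = (\<integral>\<^sup>+s. indicator {0..} s * (\<integral>\<^sup>+x. indicator {x\<in>{-pi..pi}. s < f x} x * k x \<partial>lebesgue) \<partial>lborel)"
proof -
  have [measurable]: "(\<lambda>x. indicator {-pi..pi} x * f x) \<in> borel_measurable lebesgue"
    using borel_measurable_integrable[OF f[unfolded set_integrable_def]] by simp
  have [measurable]: "{-pi..pi} \<in> sets lebesgue" by simp
  have "(\<integral>\<^sup>+x. indicator {-pi..pi} x * k x * ennreal (f x) \<partial>lebesgue)
     = (\<integral>\<^sup>+x. indicator {-pi..pi} x * k x * ennreal (indicator {-pi..pi} x * f x) \<partial>lebesgue)"
    by (intro nn_integral_cong) (auto simp: indicator_def)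
  also have "\<dots> = (\<integral>\<^sup>+s. indicator {0..} s * (\<integral>\<^sup>+x. indicator {-pi..pi} x * k x *
       indicator {x. s < indicator {-pi..pi} x * f x} x \<partial>lebesgue) \<partial>lborel)"
    by (rule layer_cake) measurable
  also have "\<dots> = (\<integral>\<^sup>+s. indicator {0..} s * (\<integral>\<^sup>+x. indicator {x\<in>{-pi..pi}. s < f x} x * k x \<partial>lebesgue) \<partial>lborel)"
  proof -
    have "indicator {-pi..pi} x * k x * indicator {x. s < indicator {-pi..pi} x * f x} x
        = indicator {x\<in>{-pi..pi}. s < f x} x * k x" for s x
      by (auto simp: indicator_def)
    then show ?thesis by simp
  qed
  finally show ?thesis .
qed

lemma nn_integral_level:
  assumes f: "set_integrable lebesgue {-pi..pi} f"
  shows "(\<integral>\<^sup>+x. indicator {-pi..pi} x * ennreal (f x) \<partial>lebesgue)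
    = (\<integral>\<^sup>+s. indicator {0..} s * ennreal (level f s) \<partial>lborel)"
    "(\<integral>\<^sup>+x. indicator {-pi..pi} x * ennreal (f x) \<partial>lebesgue) < \<infinity>"
proof -
  show "(\<integral>\<^sup>+x. indicator {-pi..pi} x * ennreal (f x) \<partial>lebesgue)
    = (\<integral>\<^sup>+s. indicator {0..} s * ennreal (level f s) \<partial>lborel)"
    using nn_integral_layers[OF f, of "\<lambda>_. 1"] superlevel_sets[OF f] emeasure_superlevel[OF f]
    by (simp add: nn_integral_indicator)
  have "(\<integral>\<^sup>+x. indicator {-pi..pi} x * ennreal (f x) \<partial>lebesgue)
     \<le> (\<integral>\<^sup>+x. norm (indicator {-pi..pi} x *\<^sub>R f x) \<partial>lebesgue)"
    by (intro nn_integral_mono) (auto simp: indicator_def intro: ennreal_leI)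
  also have "\<dots> < \<infinity>" using f by (auto simp: set_integrable_def integrable_iff_bounded)
  finally show "(\<integral>\<^sup>+x. indicator {-pi..pi} x * ennreal (f x) \<partial>lebesgue) < \<infinity>" .
qed

text \<open>Otherwise the distribution function would stay above \<open>t\<close> on a half-line and
  have infinite integral. The infimum defining \<open>decr_rearr\<close> is therefore over a
  nonempty set.\<close>

lemma ex_level_le:
  assumes f: "set_integrable lebesgue {-pi..pi} f" and "0 < t"
  shows "\<exists>s. level f s \<le> t"
proof (rule ccontr)
  assume "\<not> ?thesis"
  then have *: "t \<le> level f s" for s by (meson linorder_le_cases)
  have "(\<integral>\<^sup>+s. ennreal t * indicator {0..} s \<partial>(lborel::real measure)) \<le> (\<integral>\<^sup>+s. indicator {0..} s * ennreal (level f s) \<partial>lborel)"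
    using * by (intro nn_integral_mono) (auto simp: indicator_def intro: ennreal_leI)
  also have "\<dots> < \<infinity>" using nn_integral_level[OF f] by simp
  finally have "ennreal t * emeasure (lborel::real measure) {0..} < \<infinity>" by (simp add: nn_integral_cmult_indicator)
  moreover have "emeasure (lborel::real measure) {0..} = \<infinity>"
  proof -
    have "ennreal (real n) \<le> emeasure (lborel::real measure) {0..}" for n
      using emeasure_mono[of "{0..real n}" "{0..}" "lborel::real measure"] by simp
    then show ?thesis
      by (metis ennreal_Ex_less_of_nat ennreal_of_nat_eq_real_of_nat infinity_ennreal_def
          less_top linorder_not_le)
  qed
  ultimately show False using \<open>0 < t\<close> by (simp add: ennreal_mult_top)
qed

text \<open>Since \<open>level f\<close> is antitone, the layers \<open>s \<ge> 0\<close> with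
  \<open>t < level f s\<close> form an interval from 0 to the infimum, with or without its right
  end. This turns the infimum into an integral, to which Fubini applies.\<close>

lemma decr_rearr_layers:
  assumes f: "set_integrable lebesgue {-pi..pi} f"
    and nonneg: "AE x in lebesgue. x \<in> {-pi..pi} \<longrightarrow> 0 \<le> f x" and t: "0 < t" "t < 2 * pi"
  shows "0 \<le> decr_rearr f t"
    "ennreal (decr_rearr f t) = (\<integral>\<^sup>+s. indicator {0..} s * (if t < level f s then 1 else 0) \<partial>lborel)"
proof -
  define S where "S = {s. level f s \<le> t}"
  have eq: "decr_rearr f t = Inf S" using t by (simp add: decr_rearr_def S_def level_def)
  have ne: "S \<noteq> {}" using ex_level_le[OF f t(1)] by (auto simp: S_def)
  \<comment> \<open>Below 0 the distribution function equals \<open>2 * pi\<close>, which exceeds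
    \<open>t\<close>, so \<open>S\<close> has no negative member.\<close>
  have lb: "0 \<le> s" if "s \<in> S" for s
    using level_negative[OF f nonneg, of s] that t by (force simp: S_def)
  then have bdd: "bdd_below S" by (meson bdd_belowI)
  show nn: "0 \<le> decr_rearr f t" unfolding eq using ne lb by (intro cInf_greatest)
  note [measurable] = borel_measurable_level[OF f]
  have up: "{s\<in>{0..}. t < level f s} \<subseteq> {0..Inf S}"
  proof safe
    fix s assume s: "0 \<le> s" "t < level f s"
    have "s \<le> Inf S"
    proof (rule ccontr)
      assume "\<not> s \<le> Inf S"
      then obtain s' where "s' \<in> S" "s' < s" using cInf_lessD[OF ne, of s] by auto
      then show False using level_antimono[OF f, of s' s] s by (auto simp: S_def)
    qed
    then show "s \<in> {0..Inf S}" using s by simp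
  qed
  have low: "{0..<Inf S} \<subseteq> {s\<in>{0..}. t < level f s}"
  proof
    fix s assume s: "s \<in> {0..<Inf S}"
    then have "s \<notin> S" using cInf_lower[OF _ bdd, of s] by auto
    with s show "s \<in> {s\<in>{0..}. t < level f s}" by (auto simp: S_def)
  qed
  have m [measurable]: "{s\<in>{0..}. t < level f s} \<in> sets lborel" by measurable
  have "emeasure lborel {s\<in>{0..}. t < level f s} = ennreal (Inf S)"
    using emeasure_mono[OF up, of lborel] emeasure_mono[OF low m] nn by (auto simp: eq intro: antisym)
  moreover have "(\<integral>\<^sup>+s. indicator {0..} s * (if t < level f s then 1 else 0) \<partial>lborel)
      = (\<integral>\<^sup>+s. indicator {s\<in>{0..}. t < level f s} s \<partial>lborel)"
    by (intro nn_integral_cong) (auto simp: indicator_def)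
  ultimately show "ennreal (decr_rearr f t) = (\<integral>\<^sup>+s. indicator {0..} s * (if t < level f s then 1 else 0) \<partial>lborel)"
    by (simp add: eq)
qed

text \<open>At these points \<open>sym_rearr\<close> takes its values from the essential bounds,
  where \<open>real_of_ereal\<close> turns an infinite bound into 0.\<close>

lemma AE_interior: "AE x in lebesgue. x \<noteq> 0 \<and> x \<noteq> pi \<and> x \<noteq> - pi"
  by (intro AE_conjI AE_completion AE_lborel_singleton)

section \<open>Layers of the symmetric rearrangement and the Hardy-Littlewood inequality\<close>

context
  fixes f :: "real \<Rightarrow> real"
  assumes f: "set_integrable lebesgue {-pi..pi} f"
    and nonneg: "AE x in lebesgue. x \<in> {-pi..pi} \<longrightarrow> 0 \<le> f x"
begin

lemma sym_rearr_nonneg: "\<lbrakk>x \<noteq> 0; \<bar>x\<bar> < pi\<rbrakk> \<Longrightarrow> 0 \<le> sym_rearr f x"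
  unfolding sym_rearr_def by (rule decr_rearr_layers(1)[OF f nonneg]) auto

lemma AE_sym_rearr_nonneg: "AE x in lebesgue. x \<in> {-pi..pi} \<longrightarrow> 0 \<le> sym_rearr f x"
proof (use AE_interior in eventually_elim)
  case (elim x)
  then have "x \<in> {-pi..pi} \<longrightarrow> x \<noteq> 0 \<and> \<bar>x\<bar> < pi" by auto
  then show ?case using sym_rearr_nonneg[of x] by blast
qed

text \<open>For almost every \<open>x\<close> the layers below \<open>sym_rearr f x\<close> are the
  \<open>s\<close> with \<open>2 * \<bar>x\<bar> < level f s\<close>. Read for fixed
  \<open>s\<close>, this condition describes the centred interval of length
  \<open>level f s\<close>, so the superlevel sets of the rearrangement itself need no
  computation.\<close>

lemma nn_integral_sym_rearr:
  assumes [measurable]: "k \<in> borel_measurable lebesgue"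
  shows "(\<integral>\<^sup>+x. indicator {-pi..pi} x * k x * ennreal (sym_rearr f x) \<partial>lebesgue)
    = (\<integral>\<^sup>+s. indicator {0..} s *
        (\<integral>\<^sup>+x. indicator {- (level f s / 2)<..<level f s / 2} x * k x \<partial>lebesgue) \<partial>lborel)"
proof -
  note [measurable] = borel_measurable_level[OF f]
  have [measurable]: "{-pi..pi} \<in> sets lebesgue" "(\<lambda>x::real. x) \<in> borel_measurable lebesgue"
    by (simp_all add: measurable_completion)
  have "(\<integral>\<^sup>+x. indicator {-pi..pi} x * k x * ennreal (sym_rearr f x) \<partial>lebesgue)
    = (\<integral>\<^sup>+x. (\<integral>\<^sup>+s. indicator {-pi..pi} x * k x * (indicator {0..} s * (if 2 * \<bar>x\<bar> < level f s then 1 else 0)) \<partial>lborel) \<partial>lebesgue)"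
  proof (rule nn_integral_cong_AE, use AE_interior in eventually_elim)
    case (elim x)
    show ?case
    proof (cases "x \<in> {-pi..pi}")
      case True
      then have "0 < 2 * \<bar>x\<bar>" "2 * \<bar>x\<bar> < 2 * pi" using elim by (auto simp: abs_less_iff)
      from decr_rearr_layers(2)[OF f nonneg this] show ?thesis
        by (subst nn_integral_cmult) (auto simp: sym_rearr_def)
    qed auto
  qed
  also have "\<dots> = (\<integral>\<^sup>+s. (\<integral>\<^sup>+x. indicator {-pi..pi} x * k x * (indicator {0..} s * (if 2 * \<bar>x\<bar> < level f s then 1 else 0)) \<partial>lebesgue) \<partial>lborel)"
    by (rule lebesgue_lborel.Fubini'[symmetric]) measurable
  also have "\<dots> = (\<integral>\<^sup>+s. indicator {0..} s *
        (\<integral>\<^sup>+x. indicator {- (level f s / 2)<..<level f s / 2} x * k x \<partial>lebesgue) \<partial>lborel)"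
  proof (intro nn_integral_cong)
    fix s
    have "level f s \<le> 2 * pi" by (rule level_bounds[OF f])
    then have "indicator {-pi..pi} x * k x * (indicator {0..} s * (if 2 * \<bar>x\<bar> < level f s then 1 else 0))
       = indicator {0..} s * (indicator {- (level f s / 2)<..<level f s / 2} x * k x)" for x
      by (auto simp: indicator_def)
    then show "(\<integral>\<^sup>+x. indicator {-pi..pi} x * k x * (indicator {0..} s * (if 2 * \<bar>x\<bar> < level f s then 1 else 0)) \<partial>lebesgue)
      = indicator {0..} s * (\<integral>\<^sup>+x. indicator {- (level f s / 2)<..<level f s / 2} x * k x \<partial>lebesgue)"
      by (cases "0 \<le> s") auto
  qed
  finally show ?thesis .
qed

text \<open>The layer formula exhibits the function as a parameter integral of a jointly measurable
  integrand, except at 0 and for \<open>pi \<le> \<bar>x\<bar>\<close>, where it is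
  constant.\<close>

lemma borel_measurable_sym_rearr: "sym_rearr f \<in> borel_measurable borel"
proof -
  note [measurable] = borel_measurable_level[OF f]
  have "sym_rearr f = (\<lambda>x. if x = 0 then sym_rearr f 0 else if pi \<le> \<bar>x\<bar> then sym_rearr f pi
      else enn2real (\<integral>\<^sup>+s. indicator {0..} s * (if 2 * \<bar>x\<bar> < level f s then 1 else 0) \<partial>lborel))"
    (is "_ = ?g")
  proof
    fix x
    consider "x = 0" | "x \<noteq> 0" "pi \<le> \<bar>x\<bar>" | "x \<noteq> 0" "\<bar>x\<bar> < pi" by linarith
    then show "sym_rearr f x = ?g x"
    proof cases
      case 3
      then have t: "0 < 2 * \<bar>x\<bar>" "2 * \<bar>x\<bar> < 2 * pi" by auto
      have "sym_rearr f x = enn2real (ennreal (decr_rearr f (2 * \<bar>x\<bar>)))"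
        using decr_rearr_layers(1)[OF f nonneg t] by (simp add: sym_rearr_def)
      then show ?thesis unfolding decr_rearr_layers(2)[OF f nonneg t] using 3 by simp
    qed (auto simp: sym_rearr_def decr_rearr_def pi_gt_zero[unfolded less_le_not_le])
  qed
  also have "?g \<in> borel_measurable borel" by measurable
  finally show ?thesis .
qed

lemma nn_integral_sym_rearr_eq:
  "(\<integral>\<^sup>+x. indicator {-pi..pi} x * ennreal (sym_rearr f x) \<partial>lebesgue)
    = (\<integral>\<^sup>+x. indicator {-pi..pi} x * ennreal (f x) \<partial>lebesgue)"
proof -
  have "(\<integral>\<^sup>+x. indicator {- (level f s / 2)<..<level f s / 2} x \<partial>lebesgue) = ennreal (level f s)" for s
    using level_bounds[OF f, of s] by (simp add: nn_integral_indicator)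
  then show ?thesis
    using nn_integral_sym_rearr[of "\<lambda>_. 1"] nn_integral_level[OF f] by simp
qed

lemma sym_rearr_integrable: "set_integrable lebesgue {-pi..pi} (sym_rearr f)"
  unfolding set_integrable_def
proof (rule integrableI_bounded)
  have [measurable]: "sym_rearr f \<in> borel_measurable lebesgue"
    using borel_measurable_sym_rearr by (simp add: measurable_completion)
  have [measurable]: "{-pi..pi} \<in> sets lebesgue" by simp
  show "(\<lambda>x. indicator {-pi..pi} x *\<^sub>R sym_rearr f x) \<in> borel_measurable lebesgue" by measurable
  have "(\<integral>\<^sup>+x. norm (indicator {-pi..pi} x *\<^sub>R sym_rearr f x) \<partial>lebesgue)
     = (\<integral>\<^sup>+x. indicator {-pi..pi} x * ennreal (sym_rearr f x) \<partial>lebesgue)"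
    by (rule nn_integral_cong_AE, use AE_sym_rearr_nonneg in eventually_elim) (auto simp: indicator_def)
  also have "\<dots> < \<infinity>" using nn_integral_sym_rearr_eq nn_integral_level(2)[OF f] by simp
  finally show "(\<integral>\<^sup>+x. norm (indicator {-pi..pi} x *\<^sub>R sym_rearr f x) \<partial>lebesgue) < \<infinity>" .
qed

text \<open>A Hardy-Littlewood inequality in which \<open>V\<close> may be any even profile
  dominating the rearrangement of \<open>U\<close>. Slicing \<open>f\<close> into layers reduces it
  to \<open>nn_integral_le_centred_interval\<close>, with a superlevel set of \<open>f\<close>
  against the centred interval of the same length.\<close>

lemma rearrangement_inequality:
  fixes U V :: "real \<Rightarrow> real"
  assumes [measurable]: "U \<in> borel_measurable lebesgue" "V \<in> borel_measurable lebesgue"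
    and UV: "\<And>x y. \<lbrakk>-pi \<le> x; x \<le> y; y \<le> pi\<rbrakk> \<Longrightarrow> min (U x) (U y) \<le> V ((y - x) / 2)"
    and V: "\<And>x y. \<lbrakk>\<bar>x\<bar> \<le> \<bar>y\<bar>; \<bar>y\<bar> \<le> pi\<rbrakk> \<Longrightarrow> V y \<le> V x"
  shows "(\<integral>\<^sup>+x. indicator {-pi..pi} x * ennreal (U x) * ennreal (f x) \<partial>lebesgue)
    \<le> (\<integral>\<^sup>+x. indicator {-pi..pi} x * ennreal (V x) * ennreal (sym_rearr f x) \<partial>lebesgue)"
proof -
  have *: "(\<integral>\<^sup>+x. indicator {x\<in>{-pi..pi}. s < f x} x * ennreal (U x) \<partial>lebesgue)
     \<le> (\<integral>\<^sup>+x. indicator {- (level f s / 2)<..<level f s / 2} x * ennreal (V x) \<partial>lebesgue)" for s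
  proof (rule nn_integral_le_centred_interval[OF assms(1,2) superlevel_sets[OF f], where c=pi])
    show "emeasure lebesgue {x\<in>{-pi..pi}. s < f x} \<le> ennreal (2 * (level f s / 2))"
      unfolding emeasure_superlevel[OF f] by simp
  qed (use level_bounds[OF f, of s] in \<open>auto intro: UV V\<close>)
  have "(\<lambda>x. ennreal (U x)) \<in> borel_measurable lebesgue" "(\<lambda>x. ennreal (V x)) \<in> borel_measurable lebesgue"
    by measurable
  then show ?thesis
    by (simp only: nn_integral_layers[OF f] nn_integral_sym_rearr)
      (rule nn_integral_mono, rule mult_left_mono[OF *], simp)
qed

end


section \<open>Solutions of the Dirichlet problem\<close>

lemma G_measurable: "G x \<in> borel_measurable borel"
  unfolding G_def by measurable

text \<open>The slope in the first argument is \<open>- y / (2 * pi)\<close> plus or minus a half,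
  and both terms are at most a half in modulus. The same bound later dominates the difference
  quotients of \<open>u\<close>.\<close>

lemma G_diff_le: "\<bar>y\<bar> \<le> pi \<Longrightarrow> \<bar>G x y - G x' y\<bar> \<le> \<bar>x - x'\<bar>"
proof -
  assume y: "\<bar>y\<bar> \<le> pi"
  define d e D where "d = \<bar>x - x'\<bar>" and "e = (x - x') * (y / (2 * pi))" and "D = \<bar>x - y\<bar> - \<bar>x' - y\<bar>"
  have "G x y - G x' y = - e - D / 2"
    by (simp add: e_def D_def G_def algebra_simps diff_divide_distrib)
  moreover have "\<bar>e\<bar> \<le> d * (1 / 2)"
    unfolding e_def d_def abs_mult using y by (intro mult_left_mono) (auto simp: field_simps)
  moreover have "\<bar>D\<bar> \<le> d" unfolding D_def d_def by linarith
  ultimately show ?thesis unfolding d_def[symmetric] by linarith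
qed

lemma G_mult_integrable:
  assumes g: "set_integrable lebesgue {-pi..pi} g"
  shows "set_integrable lebesgue {-pi..pi} (\<lambda>y. G x y * g y)"
  unfolding set_integrable_def
proof (rule Bochner_Integration.integrable_bound)
  let ?C = "\<bar>x\<bar> + pi"
  have g': "integrable lebesgue (\<lambda>y. indicator {-pi..pi} y * g y)"
    using g by (simp add: set_integrable_def)
  then show "integrable lebesgue (\<lambda>y. ?C * (indicator {-pi..pi} y * g y))" by (rule integrable_mult_right)
  have [measurable]: "G x \<in> borel_measurable lebesgue"
    using G_measurable by (simp add: measurable_completion)
  have [measurable]: "(\<lambda>y. indicator {-pi..pi} y * g y) \<in> borel_measurable lebesgue" using g' by simp
  have "(\<lambda>y. G x y * (indicator {-pi..pi} y * g y)) \<in> borel_measurable lebesgue" by measurable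
  then show "(\<lambda>y. indicator {-pi..pi} y *\<^sub>R (G x y * g y)) \<in> borel_measurable lebesgue"
    by (simp add: mult.left_commute)
  have "norm (indicator {-pi..pi} y *\<^sub>R (G x y * g y)) \<le> norm (?C * (indicator {-pi..pi} y * g y))" for y
  proof (cases "y \<in> {-pi..pi}")
    case True
    then have "\<bar>G x y - G 0 y\<bar> \<le> \<bar>x\<bar>" "\<bar>G 0 y\<bar> \<le> pi"
      using G_diff_le[of y x 0] by (auto simp: G_def[of 0])
    then have "\<bar>G x y\<bar> \<le> ?C" by linarith
    then have "\<bar>G x y\<bar> * \<bar>g y\<bar> \<le> \<bar>?C\<bar> * \<bar>g y\<bar>" by (intro mult_right_mono) auto
    then show ?thesis using True by (simp add: abs_mult)
  qed simp
  then show "AE y in lebesgue. norm (indicator {-pi..pi} y *\<^sub>R (G x y * g y)) \<le> norm (?C * (indicator {-pi..pi} y * g y))"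
    by simp
qed

lemma u_lipschitz:
  assumes g: "set_integrable lebesgue {-pi..pi} g"
  shows "\<bar>u g x - u g x'\<bar> \<le> \<bar>x - x'\<bar> * (LINT y:{-pi..pi}|lebesgue. \<bar>g y\<bar>)"
proof -
  have diff: "set_integrable lebesgue {-pi..pi} (\<lambda>y. G x y * g y - G x' y * g y)"
    using G_mult_integrable[OF g] by (intro set_integral_diff)
  have abs: "set_integrable lebesgue {-pi..pi} (\<lambda>y. \<bar>x - x'\<bar> * \<bar>g y\<bar>)"
    using set_integrable_abs[OF g] by simp
  have "\<bar>u g x - u g x'\<bar> = \<bar>LINT y:{-pi..pi}|lebesgue. G x y * g y - G x' y * g y\<bar>"
    unfolding u_def using G_mult_integrable[OF g] by (subst set_integral_diff(2)) auto
  also have "\<dots> \<le> (LINT y:{-pi..pi}|lebesgue. \<bar>G x y * g y - G x' y * g y\<bar>)"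
    using set_integral_norm_bound[OF diff] by simp
  also have "\<dots> \<le> (LINT y:{-pi..pi}|lebesgue. \<bar>x - x'\<bar> * \<bar>g y\<bar>)"
  proof (rule set_integral_mono[OF set_integrable_abs[OF diff] abs])
    fix y assume "y \<in> {-pi..pi}"
    then have "\<bar>G x y - G x' y\<bar> \<le> \<bar>x - x'\<bar>" by (intro G_diff_le) auto
    then have "\<bar>G x y - G x' y\<bar> * \<bar>g y\<bar> \<le> \<bar>x - x'\<bar> * \<bar>g y\<bar>" by (intro mult_right_mono) auto
    then show "\<bar>G x y * g y - G x' y * g y\<bar> \<le> \<bar>x - x'\<bar> * \<bar>g y\<bar>"
      by (simp add: left_diff_distrib[symmetric] abs_mult)
  qed
  also have "\<dots> = \<bar>x - x'\<bar> * (LINT y:{-pi..pi}|lebesgue. \<bar>g y\<bar>)" by simp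
  finally show ?thesis .
qed

lemma continuous_on_u:
  assumes "set_integrable lebesgue {-pi..pi} g"
  shows "continuous_on S (u g)"
proof -
  let ?C = "LINT y:{-pi..pi}|lebesgue. \<bar>g y\<bar>"
  have "0 \<le> ?C" using u_lipschitz[OF assms, of 1 0] by (auto intro: order.trans[OF abs_ge_zero])
  then have "?C-lipschitz_on S (u g)"
    using u_lipschitz[OF assms] by (intro lipschitz_onI) (auto simp: dist_real_def mult.commute)
  then show ?thesis by (rule lipschitz_on_continuous_on)
qed

lemma u_measurable:
  assumes "set_integrable lebesgue {-pi..pi} g"
  shows "u g \<in> borel_measurable borel"
  using continuous_on_u[OF assms, of UNIV] by (rule borel_measurable_continuous_onI)

lemma u_even:
  assumes "\<And>y. g (- y) = g y"
  shows "u g (- x) = u g x"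
proof -
  have "u g x = (\<integral>y. indicator {-pi..pi} (0 + (-1) * y) *\<^sub>R (G x (0 + (-1) * y) * g (0 + (-1) * y)) \<partial>lebesgue)"
    unfolding u_def set_lebesgue_integral_def
    by (subst lebesgue_integral_real_affine[where c="-1" and t=0]) auto
  also have "\<dots> = u g (- x)"
    unfolding u_def set_lebesgue_integral_def
    by (intro Bochner_Integration.integral_cong) (auto simp: assms indicator_def G_def abs_minus_commute)
  finally show ?thesis by simp
qed

lemma ennreal_set_integral_mult:
  fixes k g :: "real \<Rightarrow> real"
  assumes kg: "set_integrable lebesgue {-pi..pi} (\<lambda>y. k y * g y)"
    and k: "\<And>y. y \<in> {-pi..pi} \<Longrightarrow> 0 \<le> k y"
    and g: "AE y in lebesgue. y \<in> {-pi..pi} \<longrightarrow> 0 \<le> g y"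
  shows "(\<integral>\<^sup>+y. indicator {-pi..pi} y * ennreal (k y) * ennreal (g y) \<partial>lebesgue)
    = ennreal (LINT y:{-pi..pi}|lebesgue. k y * g y)"
proof -
  have "(\<integral>\<^sup>+y. indicator {-pi..pi} y * ennreal (k y) * ennreal (g y) \<partial>lebesgue)
    = (\<integral>\<^sup>+y. ennreal (indicator {-pi..pi} y *\<^sub>R (k y * g y)) \<partial>lebesgue)"
    using k by (intro nn_integral_cong) (auto simp: indicator_def ennreal_mult')
  also have "\<dots> = ennreal (LINT y:{-pi..pi}|lebesgue. k y * g y)"
    unfolding set_lebesgue_integral_def
  proof (rule nn_integral_eq_integral)
    show "AE y in lebesgue. 0 \<le> indicator {-pi..pi} y *\<^sub>R (k y * g y)"
      using g by eventually_elim (use k in \<open>auto simp: indicator_def\<close>)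
  qed (use kg in \<open>simp add: set_integrable_def\<close>)
  finally show ?thesis .
qed

section \<open>Sign, boundary values and concavity of \<open>u f\<close>\<close>

context
  fixes f :: "real \<Rightarrow> real"
  assumes f: "set_integrable lebesgue {-pi..pi} f"
    and nonneg: "AE x in lebesgue. x \<in> {-pi..pi} \<longrightarrow> 0 \<le> f x"
begin

lemma u_nonneg: "x \<in> {-pi..pi} \<Longrightarrow> 0 \<le> u f x"
  unfolding u_def set_lebesgue_integral_def
  by (rule integral_nonneg_AE, use nonneg in eventually_elim) (auto simp: indicator_def G_nonneg)

lemma u_boundary: "u f pi = 0" "u f (- pi) = 0"
proof -
  have "G pi y = 0" "G (-pi) y = 0" if "y \<in> {-pi..pi}" for y
    using that by (auto simp: G_def field_simps)
  then have "(\<lambda>y. indicator {-pi..pi} y *\<^sub>R (G pi y * f y)) = (\<lambda>y. 0)"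
    "(\<lambda>y. indicator {-pi..pi} y *\<^sub>R (G (-pi) y * f y)) = (\<lambda>y. 0)"
    by (auto simp: indicator_def)
  then show "u f pi = 0" "u f (- pi) = 0" unfolding u_def set_lebesgue_integral_def by simp_all
qed

text \<open>\<open>G\<close> is concave in its first argument because of the term
  \<open>- \<bar>x - y\<bar> / 2\<close>, and integration against a nonnegative function preserves
  this.\<close>

lemma u_concave:
  assumes "0 \<le> t" "t \<le> 1"
  shows "(1 - t) * u f a + t * u f b \<le> u f ((1 - t) * a + t * b)"
proof -
  have Gc: "(1 - t) * G a y + t * G b y \<le> G ((1 - t) * a + t * b) y" for y
  proof -
    have "\<bar>(1 - t) * a + t * b - y\<bar> = \<bar>(1 - t) * (a - y) + t * (b - y)\<bar>" by (simp add: algebra_simps)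
    also have "\<dots> \<le> (1 - t) * \<bar>a - y\<bar> + t * \<bar>b - y\<bar>"
      using assms abs_triangle_ineq[of "(1 - t) * (a - y)" "t * (b - y)"] by (simp add: abs_mult)
    finally have "\<bar>(1 - t) * a + t * b - y\<bar> \<le> (1 - t) * \<bar>a - y\<bar> + t * \<bar>b - y\<bar>" .
    then have "0 \<le> ((1 - t) * \<bar>a - y\<bar> + t * \<bar>b - y\<bar> - \<bar>(1 - t) * a + t * b - y\<bar>) / 2" by simp
    also have "\<dots> = G ((1 - t) * a + t * b) y - ((1 - t) * G a y + t * G b y)"
      by (simp add: G_def diff_divide_distrib add_divide_distrib algebra_simps)
    finally show ?thesis by simp
  qed
  have int: "set_integrable lebesgue {-pi..pi} (\<lambda>y. (1 - t) * (G a y * f y) + t * (G b y * f y))"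
    by (intro set_integral_add(1) set_integrable_mult_right G_mult_integrable f)
  have "(1 - t) * u f a + t * u f b = (LINT y:{-pi..pi}|lebesgue. (1 - t) * (G a y * f y) + t * (G b y * f y))"
    unfolding u_def
    by (subst set_integral_add(2)) (auto intro!: set_integrable_mult_right G_mult_integrable f)
  also have "\<dots> \<le> u f ((1 - t) * a + t * b)"
    unfolding u_def
  proof (rule set_integral_mono_AE[OF int G_mult_integrable[OF f]])
    show "AE y\<in>{-pi..pi} in lebesgue. (1 - t) * (G a y * f y) + t * (G b y * f y) \<le> G ((1 - t) * a + t * b) y * f y"
      using nonneg
    proof eventually_elim
      case (elim y)
      show ?case
        using mult_right_mono[OF Gc[of y], of "f y"] elim by (auto simp: algebra_simps)
    qed
  qed
  finally show ?thesis .
qed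

text \<open>A concave function is smallest at an end of an interval. Applied to the even function
  \<open>u (sym_rearr f)\<close> this gives monotonicity in \<open>\<bar>x\<bar>\<close>; applied to
  \<open>u f\<close> it fills in superlevel sets in the equality case.\<close>

lemma u_ge_min_between:
  assumes "\<bar>x\<bar> \<le> b"
  shows "min (u f (- b)) (u f b) \<le> u f x"
proof (cases "b = 0")
  case False
  then have b: "0 < b" using assms by linarith
  define t where "t = (x + b) / (2 * b)"
  have t: "0 \<le> t" "t \<le> 1" using assms b by (auto simp: t_def field_simps abs_le_iff)
  have x: "(1 - t) * (- b) + t * b = x" using b by (simp add: t_def field_simps)
  have "min (u f (- b)) (u f b) = (1 - t) * min (u f (- b)) (u f b) + t * min (u f (- b)) (u f b)"
    by (simp add: algebra_simps)
  also have "\<dots> \<le> (1 - t) * u f (- b) + t * u f b"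
    using t by (intro add_mono mult_left_mono) auto
  also have "\<dots> \<le> u f x" using u_concave[OF t, of "-b" b] x by simp
  finally show ?thesis .
qed (use assms in simp)

end

section \<open>Pointwise comparison of \<open>u f\<close> with
  \<open>u (sym_rearr f)\<close>\<close>

context
  fixes f :: "real \<Rightarrow> real"
  assumes f: "set_integrable lebesgue {-pi..pi} f"
    and nonneg: "AE x in lebesgue. x \<in> {-pi..pi} \<longrightarrow> 0 \<le> f x"
begin

lemma u_sym_rearr_even: "u (sym_rearr f) (- x) = u (sym_rearr f) x"
  by (rule u_even) (simp add: sym_rearr_def)

lemma u_sym_rearr_antimono:
  assumes "\<bar>x\<bar> \<le> \<bar>y\<bar>"
  shows "u (sym_rearr f) y \<le> u (sym_rearr f) x"
  using u_ge_min_between[OF sym_rearr_integrable[OF f nonneg] AE_sym_rearr_nonneg[OF f nonneg] assms]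
    u_sym_rearr_even[of y] by (auto simp: abs_if split: if_splits)

text \<open>The rearrangement inequality for the kernels \<open>K\<close> and \<open>H\<close>.
  Integrating \<open>K\<close> against \<open>f\<close> gives the weighted mean on the left;
  integrating \<open>H\<close> against \<open>sym_rearr f\<close> gives \<open>\<kappa>\<close>
  times the mean of the values at \<open>r\<close> and \<open>- r\<close>, which agree by
  evenness.\<close>

lemma u_weighted_le:
  fixes a b :: real
  defines "p \<equiv> pi + a" and "q \<equiv> pi - b"
  assumes ab: "-pi \<le> a" "a \<le> b" "b \<le> pi" "b - a < 2 * pi"
  shows "(q * u f a + p * u f b) / (p + q) \<le> 4 * p * q / (p + q)\<^sup>2 * u (sym_rearr f) ((b - a) / 2)"
proof -
  define r where "r = (b - a) / 2"
  define \<kappa> where "\<kappa> = 4 * p * q / (p + q)\<^sup>2"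
  define K where "K = (\<lambda>z. (q * G a z + p * G b z) / (p + q))"
  define H where "H = (\<lambda>z. \<kappa> * ((G r z + G (- r) z) / 2))"
  have pq: "0 \<le> p" "0 \<le> q" "0 < p + q" using ab by (auto simp: p_def q_def)
  have \<kappa>: "0 \<le> \<kappa>" using pq by (simp add: \<kappa>_def)
  have r: "0 \<le> r" "r \<le> pi" using ab by (auto simp: r_def)
  note fs = sym_rearr_integrable[OF f nonneg]
  have [measurable]: "G x \<in> borel_measurable lebesgue" for x
    using G_measurable by (simp add: measurable_completion)
  have Km: "K \<in> borel_measurable lebesgue" unfolding K_def by measurable
  have Hm: "H \<in> borel_measurable lebesgue" unfolding H_def by measurable
  have "(\<integral>\<^sup>+x. indicator {-pi..pi} x * ennreal (K x) * ennreal (f x) \<partial>lebesgue)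
    \<le> (\<integral>\<^sup>+x. indicator {-pi..pi} x * ennreal (H x) * ennreal (sym_rearr f x) \<partial>lebesgue)"
  proof (rule rearrangement_inequality[OF f nonneg Km Hm])
    show "min (K x) (K y) \<le> H ((y - x) / 2)" if "-pi \<le> x" "x \<le> y" "y \<le> pi" for x y
      using trapezoid_levels[OF ab that] by (simp add: K_def H_def \<kappa>_def p_def q_def r_def)
    show "H y \<le> H x" if "\<bar>x\<bar> \<le> \<bar>y\<bar>" "\<bar>y\<bar> \<le> pi" for x y
      unfolding H_def G_symmetric_average using \<kappa> that by (intro mult_left_mono) (auto simp: min_def)
  qed
  moreover have "(\<integral>\<^sup>+x. indicator {-pi..pi} x * ennreal (K x) * ennreal (f x) \<partial>lebesgue)
      = ennreal ((q * u f a + p * u f b) / (p + q))"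
  proof -
    have eq: "K y * f y = (q / (p + q)) * (G a y * f y) + (p / (p + q)) * (G b y * f y)" for y
      unfolding K_def by (simp add: algebra_simps add_divide_distrib)
    have i: "set_integrable lebesgue {-pi..pi} (\<lambda>y. c * (G x y * f y))" for c x
      by (intro set_integrable_mult_right G_mult_integrable f)
    have int: "set_integrable lebesgue {-pi..pi} (\<lambda>y. K y * f y)"
      unfolding eq by (intro set_integral_add(1) i)
    have eq': "(LINT y:{-pi..pi}|lebesgue. K y * f y) = (q * u f a + p * u f b) / (p + q)"
      unfolding eq u_def by (subst set_integral_add(2)[OF i i]) (simp add: add_divide_distrib)
    have K0: "0 \<le> K y" if "y \<in> {-pi..pi}" for y
      unfolding K_def using G_nonneg[of a y] G_nonneg[of b y] ab that pq
      by (intro divide_nonneg_nonneg add_nonneg_nonneg mult_nonneg_nonneg) auto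
    show ?thesis using ennreal_set_integral_mult[OF int K0 nonneg] unfolding eq' .
  qed
  moreover have "(\<integral>\<^sup>+x. indicator {-pi..pi} x * ennreal (H x) * ennreal (sym_rearr f x) \<partial>lebesgue)
      = ennreal (\<kappa> * u (sym_rearr f) r)"
  proof -
    have eq: "H y * sym_rearr f y = (\<kappa> / 2) * (G r y * sym_rearr f y) + (\<kappa> / 2) * (G (- r) y * sym_rearr f y)" for y
      unfolding H_def by (simp add: algebra_simps add_divide_distrib)
    have i: "set_integrable lebesgue {-pi..pi} (\<lambda>y. c * (G x y * sym_rearr f y))" for c x
      by (intro set_integrable_mult_right G_mult_integrable fs)
    have int: "set_integrable lebesgue {-pi..pi} (\<lambda>y. H y * sym_rearr f y)"
      unfolding eq by (intro set_integral_add(1) i)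
    have "(LINT y:{-pi..pi}|lebesgue. H y * sym_rearr f y)
        = \<kappa> / 2 * u (sym_rearr f) r + \<kappa> / 2 * u (sym_rearr f) (- r)"
      unfolding eq u_def by (subst set_integral_add(2)[OF i i]) simp
    also have "\<dots> = \<kappa> * u (sym_rearr f) r" by (simp add: u_sym_rearr_even)
    finally have eq': "(LINT y:{-pi..pi}|lebesgue. H y * sym_rearr f y) = \<kappa> * u (sym_rearr f) r" .
    have H0: "0 \<le> H y" if "y \<in> {-pi..pi}" for y
      unfolding H_def using G_nonneg[of r y] G_nonneg[of "-r" y] r \<kappa> that
      by (intro divide_nonneg_nonneg add_nonneg_nonneg mult_nonneg_nonneg) auto
    show ?thesis using ennreal_set_integral_mult[OF int H0 AE_sym_rearr_nonneg[OF f nonneg]] unfolding eq' .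
  qed
  ultimately have "ennreal ((q * u f a + p * u f b) / (p + q)) \<le> ennreal (\<kappa> * u (sym_rearr f) r)"
    by metis
  moreover have "0 \<le> \<kappa> * u (sym_rearr f) r"
    using u_nonneg[OF fs AE_sym_rearr_nonneg[OF f nonneg], of r] r \<kappa> by simp
  ultimately show ?thesis unfolding \<kappa>_def r_def by (rule iffD1[OF ennreal_le_iff, rotated])
qed

lemma min_u_le_weighted:
  fixes a b :: real
  defines "p \<equiv> pi + a" and "q \<equiv> pi - b"
  assumes ab: "-pi \<le> a" "a \<le> b" "b \<le> pi" "b - a < 2 * pi"
  shows "min (u f a) (u f b) \<le> 4 * p * q / (p + q)\<^sup>2 * u (sym_rearr f) ((b - a) / 2)"
proof -
  have pq: "0 \<le> p" "0 \<le> q" "0 < p + q" using ab by (auto simp: p_def q_def)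
  define m where "m = min (u f a) (u f b)"
  have "m * (p + q) = q * m + p * m" by (simp add: algebra_simps)
  also have "\<dots> \<le> q * u f a + p * u f b" using pq by (intro add_mono mult_left_mono) (auto simp: m_def)
  finally have "m \<le> (q * u f a + p * u f b) / (p + q)" using pq by (simp add: pos_le_divide_eq)
  also have "\<dots> \<le> 4 * p * q / (p + q)\<^sup>2 * u (sym_rearr f) ((b - a) / 2)"
    unfolding p_def q_def by (rule u_weighted_le[OF ab])
  finally show ?thesis by (simp add: m_def)
qed

lemma min_u_le:
  assumes ab: "-pi \<le> a" "a \<le> b" "b \<le> pi"
  shows "min (u f a) (u f b) \<le> u (sym_rearr f) ((b - a) / 2)"
proof (cases "b - a < 2 * pi")
  case True
  have "0 \<le> u (sym_rearr f) ((b - a) / 2)"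
    using u_nonneg[OF sym_rearr_integrable[OF f nonneg] AE_sym_rearr_nonneg[OF f nonneg]] ab by auto
  moreover have "4 * (pi + a) * (pi - b) / (pi + a + (pi - b))\<^sup>2 \<le> 1"
    using True by (intro four_mult_div_sum_squared) simp
  ultimately have "4 * (pi + a) * (pi - b) / (pi + a + (pi - b))\<^sup>2 * u (sym_rearr f) ((b - a) / 2)
      \<le> 1 * u (sym_rearr f) ((b - a) / 2)"
    by (intro mult_right_mono)
  with min_u_le_weighted[OF ab True] show ?thesis unfolding mult_1 by (rule order.trans)
next
  \<comment> \<open>Here \<open>p + q = 0\<close> and the weighted mean degenerates, but all values
    involved are boundary values, hence 0.\<close>
  case False
  then have "a = -pi" "b = pi" using ab by auto
  then show ?thesis
    using u_boundary[OF f nonneg] u_boundary[OF sym_rearr_integrable[OF f nonneg] AE_sym_rearr_nonneg[OF f nonneg]] by simp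
qed

end


section \<open>Comparison of integrals\<close>

lemma set_integrable_bounded:
  fixes W :: "real \<Rightarrow> real"
  assumes [measurable]: "W \<in> borel_measurable lebesgue" "E \<in> sets lebesgue"
    and E: "E \<subseteq> {-pi..pi}" and W: "\<And>x. x \<in> E \<Longrightarrow> \<bar>W x\<bar> \<le> C"
  shows "set_integrable lebesgue E W"
  unfolding set_integrable_def
proof (rule integrableI_bounded_set[where A="{-pi..pi}" and B="\<bar>C\<bar>"])
  show "AE x in lebesgue. x \<in> {-pi..pi} \<longrightarrow> norm (indicator E x *\<^sub>R W x) \<le> \<bar>C\<bar>"
  proof -
    have "\<bar>W x\<bar> \<le> \<bar>C\<bar>" if "x \<in> E" for x using W[OF that] by linarith
    then show ?thesis by (intro AE_I2) (auto simp: indicator_def)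
  qed
  show "(\<lambda>x. indicator E x *\<^sub>R W x) \<in> borel_measurable lebesgue" by measurable
  show "AE x in lebesgue. x \<notin> {-pi..pi} \<longrightarrow> indicator E x *\<^sub>R W x = 0"
    using E by (intro AE_I2) (auto simp: indicator_def)
qed auto

lemma ennreal_set_integral:
  fixes W :: "real \<Rightarrow> real"
  assumes "set_integrable lebesgue E W" and "\<And>x. x \<in> E \<Longrightarrow> 0 \<le> W x"
  shows "(\<integral>\<^sup>+x. indicator E x * ennreal (W x) \<partial>lebesgue) = ennreal (LINT x:E|lebesgue. W x)"
proof -
  have "(\<integral>\<^sup>+x. indicator E x * ennreal (W x) \<partial>lebesgue) = (\<integral>\<^sup>+x. ennreal (indicator E x *\<^sub>R W x) \<partial>lebesgue)"
    by (intro nn_integral_cong) (auto simp: indicator_def)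
  also have "\<dots> = ennreal (LINT x:E|lebesgue. W x)"
    unfolding set_lebesgue_integral_def
    by (rule nn_integral_eq_integral) (use assms in \<open>auto simp: set_integrable_def indicator_def\<close>)
  finally show ?thesis .
qed

text \<open>The freedom in \<open>B\<close> covers both the open interval used for the star function
  and the closed interval \<open>{-pi..pi}\<close>; enlarging the domain is harmless because
  \<open>V\<close> is nonnegative.\<close>

lemma set_integral_le_centred:
  fixes U V :: "real \<Rightarrow> real"
  assumes m: "U \<in> borel_measurable lebesgue" "V \<in> borel_measurable lebesgue"
    and E: "E \<in> sets lebesgue" "E \<subseteq> {-pi..pi}" "emeasure lebesgue E \<le> ennreal (2 * \<rho>)" and \<rho>: "0 \<le> \<rho>" "\<rho> \<le> pi"
    and B: "B \<in> sets lebesgue" "{-\<rho><..<\<rho>} \<subseteq> B" "B \<subseteq> {-pi..pi}"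
    and UV: "\<And>x y. \<lbrakk>-pi \<le> x; x \<le> y; y \<le> pi\<rbrakk> \<Longrightarrow> min (U x) (U y) \<le> V ((y - x) / 2)"
    and V: "\<And>x y. \<lbrakk>\<bar>x\<bar> \<le> \<bar>y\<bar>; \<bar>y\<bar> \<le> pi\<rbrakk> \<Longrightarrow> V y \<le> V x"
    and nn: "\<And>x. \<bar>x\<bar> \<le> pi \<Longrightarrow> 0 \<le> U x" "\<And>x. \<bar>x\<bar> \<le> pi \<Longrightarrow> 0 \<le> V x"
  shows "(LINT x:E|lebesgue. U x) \<le> (LINT x:B|lebesgue. V x)"
proof -
  have iU: "set_integrable lebesgue E U"
  proof (rule set_integrable_bounded[OF m(1) E(1,2)])
    \<comment> \<open>The two-point hypothesis with both points equal to \<open>x\<close> gives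
      \<open>U x \<le> V 0\<close>.\<close>
    show "\<bar>U x\<bar> \<le> V 0" if "x \<in> E" for x
      using UV[of x x] nn(1)[of x] that E(2) by (auto simp: abs_le_iff subset_eq)
  qed
  have iV: "set_integrable lebesgue B V"
  proof (rule set_integrable_bounded[OF m(2) B(1,3)])
    show "\<bar>V x\<bar> \<le> V 0" if "x \<in> B" for x
      using V[of 0 x] nn(2)[of x] that B(3) by (auto simp: abs_le_iff subset_eq)
  qed
  have U0: "0 \<le> U x" if "x \<in> E" for x
    using that E(2) by (intro nn) (auto simp: abs_le_iff subset_eq)
  have V0: "0 \<le> V x" if "x \<in> B" for x
    using that B(3) by (intro nn) (auto simp: abs_le_iff subset_eq)
  have "ennreal (LINT x:E|lebesgue. U x) = (\<integral>\<^sup>+x. indicator E x * ennreal (U x) \<partial>lebesgue)"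
    by (rule ennreal_set_integral[OF iU U0, symmetric])
  also have "\<dots> \<le> (\<integral>\<^sup>+x. indicator {-\<rho><..<\<rho>} x * ennreal (V x) \<partial>lebesgue)"
    by (rule nn_integral_le_centred_interval[OF m E \<rho> UV V])
  also have "\<dots> \<le> (\<integral>\<^sup>+x. indicator B x * ennreal (V x) \<partial>lebesgue)"
    using B(2) by (intro nn_integral_mono mult_right_mono) (auto simp: indicator_def)
  also have "\<dots> = ennreal (LINT x:B|lebesgue. V x)" by (rule ennreal_set_integral[OF iV V0])
  finally have "ennreal (LINT x:E|lebesgue. U x) \<le> ennreal (LINT x:B|lebesgue. V x)" .
  moreover have "0 \<le> (LINT x:B|lebesgue. V x)"
    unfolding set_lebesgue_integral_def
    by (rule Bochner_Integration.integral_nonneg) (use V0 in \<open>auto simp: indicator_def\<close>)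
  ultimately show ?thesis by (simp add: ennreal_le_iff)
qed

lemma mono_comp_integrable:
  fixes \<phi> W :: "real \<Rightarrow> real"
  assumes "mono \<phi>" and W: "W \<in> borel_measurable borel" "\<And>x. \<bar>x\<bar> \<le> pi \<Longrightarrow> 0 \<le> W x \<and> W x \<le> C"
  shows "set_integrable lebesgue {-pi..pi} (\<lambda>x. \<phi> (W x))"
proof (rule set_integrable_bounded)
  have "(\<lambda>x. \<phi> (W x)) \<in> borel_measurable borel"
    using measurable_compose[OF W(1) borel_measurable_mono[OF \<open>mono \<phi>\<close>]] .
  then show "(\<lambda>x. \<phi> (W x)) \<in> borel_measurable lebesgue" by (simp add: measurable_completion)
  show "\<bar>\<phi> (W x)\<bar> \<le> \<bar>\<phi> 0\<bar> + \<bar>\<phi> C\<bar>" if "x \<in> {-pi..pi}" for x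
  proof -
    have "0 \<le> W x" "W x \<le> C" using that W(2)[of x] by auto
    then have "\<phi> 0 \<le> \<phi> (W x)" "\<phi> (W x) \<le> \<phi> C" using \<open>mono \<phi>\<close> by (auto dest: monoD)
    then show ?thesis by linarith
  qed
qed auto

text \<open>A monotone \<open>\<phi>\<close> commutes with \<open>min\<close>, so the two-point
  hypothesis passes to the compositions. Subtracting \<open>\<phi> 0\<close> makes them nonnegative,
  and the whole interval serves as \<open>E\<close> and as \<open>B\<close>.\<close>

lemma integral_mono_comp_le:
  fixes \<phi> U V :: "real \<Rightarrow> real"
  assumes "mono \<phi>" and m: "U \<in> borel_measurable borel" "V \<in> borel_measurable borel"
    and UV: "\<And>x y. \<lbrakk>-pi \<le> x; x \<le> y; y \<le> pi\<rbrakk> \<Longrightarrow> min (U x) (U y) \<le> V ((y - x) / 2)"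
    and V: "\<And>x y. \<lbrakk>\<bar>x\<bar> \<le> \<bar>y\<bar>; \<bar>y\<bar> \<le> pi\<rbrakk> \<Longrightarrow> V y \<le> V x"
    and nn: "\<And>x. \<bar>x\<bar> \<le> pi \<Longrightarrow> 0 \<le> U x" "\<And>x. \<bar>x\<bar> \<le> pi \<Longrightarrow> 0 \<le> V x"
  shows "(LINT x:{-pi..pi}|lebesgue. \<phi> (U x)) \<le> (LINT x:{-pi..pi}|lebesgue. \<phi> (V x))"
proof -
  have bU: "0 \<le> U x \<and> U x \<le> V 0" if "\<bar>x\<bar> \<le> pi" for x using UV[of x x] nn(1)[of x] that by auto
  have bV: "0 \<le> V x \<and> V x \<le> V 0" if "\<bar>x\<bar> \<le> pi" for x using V[of 0 x] nn(2)[of x] that by auto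
  note iU = mono_comp_integrable[OF \<open>mono \<phi>\<close> m(1) bU]
  note iV = mono_comp_integrable[OF \<open>mono \<phi>\<close> m(2) bV]
  have c: "set_integrable lebesgue {-pi..pi} (\<lambda>x. \<phi> 0)"
    by (rule set_integrable_bounded[where C="\<bar>\<phi> 0\<bar>"]) auto
  have [measurable]: "\<phi> \<in> borel_measurable borel" by (rule borel_measurable_mono[OF \<open>mono \<phi>\<close>])
  note [measurable] = m
  have "(LINT x:{-pi..pi}|lebesgue. \<phi> (U x) - \<phi> 0) \<le> (LINT x:{-pi..pi}|lebesgue. \<phi> (V x) - \<phi> 0)"
  proof (rule set_integral_le_centred[where \<rho>=pi])
    have "(\<lambda>x. \<phi> (U x) - \<phi> 0) \<in> borel_measurable borel" "(\<lambda>x. \<phi> (V x) - \<phi> 0) \<in> borel_measurable borel"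
      by measurable
    then show "(\<lambda>x. \<phi> (U x) - \<phi> 0) \<in> borel_measurable lebesgue" "(\<lambda>x. \<phi> (V x) - \<phi> 0) \<in> borel_measurable lebesgue"
      by (simp_all add: measurable_completion)
    show "min (\<phi> (U x) - \<phi> 0) (\<phi> (U y) - \<phi> 0) \<le> \<phi> (V ((y - x) / 2)) - \<phi> 0"
      if "-pi \<le> x" "x \<le> y" "y \<le> pi" for x y
    proof -
      have "\<phi> (min (U x) (U y)) \<le> \<phi> (V ((y - x) / 2))"
        by (rule monoD[OF \<open>mono \<phi>\<close> UV[OF that]])
      then show ?thesis by (auto simp: min_def split: if_splits)
    qed
    show "\<phi> (V y) - \<phi> 0 \<le> \<phi> (V x) - \<phi> 0" if "\<bar>x\<bar> \<le> \<bar>y\<bar>" "\<bar>y\<bar> \<le> pi" for x y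
      using monoD[OF \<open>mono \<phi>\<close> V[OF that]] by simp
    show "0 \<le> \<phi> (U x) - \<phi> 0" "0 \<le> \<phi> (V x) - \<phi> 0" if "\<bar>x\<bar> \<le> pi" for x
      using monoD[OF \<open>mono \<phi>\<close> nn(1)[OF that]] monoD[OF \<open>mono \<phi>\<close> nn(2)[OF that]] by auto
  qed auto
  then show ?thesis by (simp add: set_integral_diff(2)[OF iU c] set_integral_diff(2)[OF iV c])
qed

section \<open>Integral and star function comparison for \<open>u f\<close>\<close>

context
  fixes f :: "real \<Rightarrow> real"
  assumes f: "set_integrable lebesgue {-pi..pi} f"
    and nonneg: "AE x in lebesgue. x \<in> {-pi..pi} \<longrightarrow> 0 \<le> f x"
begin

lemmas sym_rearr_facts = sym_rearr_integrable[OF f nonneg] AE_sym_rearr_nonneg[OF f nonneg]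

lemma u_sym_rearr_antimono_on:
  "\<lbrakk>\<bar>x\<bar> \<le> \<bar>y\<bar>; \<bar>y\<bar> \<le> pi\<rbrakk> \<Longrightarrow> u (sym_rearr f) y \<le> u (sym_rearr f) x"
  by (rule u_sym_rearr_antimono[OF f nonneg])

lemma u_nonneg_abs: "\<bar>x\<bar> \<le> pi \<Longrightarrow> 0 \<le> u f x" "\<bar>x\<bar> \<le> pi \<Longrightarrow> 0 \<le> u (sym_rearr f) x"
  using u_nonneg[OF f nonneg, of x] u_nonneg[OF sym_rearr_facts, of x] by (auto simp: abs_le_iff)

lemma integral_comp_u_le:
  fixes \<phi> :: "real \<Rightarrow> real"
  assumes "mono \<phi>"
  shows "(LINT x:{-pi..pi}|lebesgue. \<phi> (u f x)) \<le> (LINT x:{-pi..pi}|lebesgue. \<phi> (u (sym_rearr f) x))"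
  by (rule integral_mono_comp_le[OF assms u_measurable[OF f] u_measurable[OF sym_rearr_facts(1)]
      min_u_le[OF f nonneg] u_sym_rearr_antimono_on u_nonneg_abs])

text \<open>Every competitor for \<open>u f\<close> is at most the integral of
  \<open>u (sym_rearr f)\<close> over the centred interval of measure \<open>t\<close>, and that
  interval is a competitor for \<open>u (sym_rearr f)\<close>.\<close>

lemma star_fun_u_le:
  assumes t: "t \<in> {0..2 * pi}"
  shows "star_fun (u f) t \<le> star_fun (u (sym_rearr f)) t"
proof -
  let ?v = "u (sym_rearr f)"
  let ?S = "\<lambda>g. {(LINT x:E|lebesgue. g x) | E. E \<in> sets borel \<and> E \<subseteq> {-pi..pi} \<and> measure lebesgue E = t}"
  have m: "u f \<in> borel_measurable lebesgue" "?v \<in> borel_measurable lebesgue"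
    using u_measurable[OF f] u_measurable[OF sym_rearr_facts(1)] by (simp_all add: measurable_completion)
  have le: "(LINT x:E|lebesgue. g x) \<le> (LINT x:B|lebesgue. ?v x)"
    if g: "g \<in> borel_measurable lebesgue" "\<And>x y. \<lbrakk>-pi \<le> x; x \<le> y; y \<le> pi\<rbrakk> \<Longrightarrow> min (g x) (g y) \<le> ?v ((y - x) / 2)"
      "\<And>x. \<bar>x\<bar> \<le> pi \<Longrightarrow> 0 \<le> g x"
      and E: "E \<in> sets borel" "E \<subseteq> {-pi..pi}" "measure lebesgue E = t"
      and B: "B \<in> sets borel" "{-(t/2)<..<t/2} \<subseteq> B" "B \<subseteq> {-pi..pi}" for g E B
  proof (rule set_integral_le_centred[OF g(1) m(2) _ E(2) _ _ _ _ B(2,3) g(2)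
        u_sym_rearr_antimono_on g(3) u_nonneg_abs(2)])
    have "emeasure lebesgue E \<le> emeasure lebesgue {-pi..pi}" using E by (intro emeasure_mono) auto
    then have "emeasure lebesgue E < \<infinity>" by (rule order.strict_trans1) simp
    then have "emeasure lebesgue E = ennreal t" using E(3) emeasure_eq_ennreal_measure[of lebesgue E] by simp
    then show "emeasure lebesgue E \<le> ennreal (2 * (t / 2))" by simp
  qed (use t E B in auto)
  have top: "(LINT x:{-(t/2)<..<t/2}|lebesgue. ?v x) \<in> ?S ?v"
    using t by (intro CollectI exI[of _ "{-(t/2)<..<t/2}"]) auto
  \<comment> \<open>Of two points, the one farther from 0 has modulus at least half their distance,
    so \<open>?v\<close> satisfies the two-point hypothesis with itself.\<close>
  have vmin: "min (?v x) (?v y) \<le> ?v ((y - x) / 2)" if "-pi \<le> x" "x \<le> y" "y \<le> pi" for x y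
  proof (cases "(y - x) / 2 \<le> \<bar>x\<bar>")
    case True
    then show ?thesis using u_sym_rearr_antimono[OF f nonneg, of "(y - x) / 2" x] that by (auto simp: min_le_iff_disj)
  next
    case False
    then have "(y - x) / 2 \<le> \<bar>y\<bar>" by (cases "0 \<le> x"; cases "0 \<le> y") auto
    then have "\<bar>(y - x) / 2\<bar> \<le> \<bar>y\<bar>" using that by simp
    then show ?thesis using u_sym_rearr_antimono[OF f nonneg, of "(y - x) / 2" y] by (auto simp: min_le_iff_disj)
  qed
  \<comment> \<open>A real \<open>Sup\<close> bounds its set only if the set is bounded above; here
    \<open>le\<close> is used with \<open>g = ?v\<close> and the full interval as
    \<open>B\<close>.\<close>
  have bdd: "bdd_above (?S ?v)"
  proof (rule bdd_aboveI)
    fix z assume "z \<in> ?S ?v"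
    then obtain E where E: "z = (LINT x:E|lebesgue. ?v x)" "E \<in> sets borel" "E \<subseteq> {-pi..pi}" "measure lebesgue E = t"
      by auto
    show "z \<le> (LINT x:{-pi..pi}|lebesgue. ?v x)"
      unfolding E(1) using t by (intro le[OF m(2) vmin u_nonneg_abs(2) E(2-4)]) auto
  qed
  show ?thesis unfolding star_fun_def
  proof (rule cSup_least)
    show "?S (u f) \<noteq> {}"
    proof -
      have "(LINT x:{-(t/2)<..<t/2}|lebesgue. u f x) \<in> ?S (u f)"
        using t by (intro CollectI exI[of _ "{-(t/2)<..<t/2}"]) auto
      then show ?thesis by blast
    qed
    fix z assume "z \<in> ?S (u f)"
    then obtain E where E: "z = (LINT x:E|lebesgue. u f x)" "E \<in> sets borel" "E \<subseteq> {-pi..pi}" "measure lebesgue E = t"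
      by auto
    have "z \<le> (LINT x:{-(t/2)<..<t/2}|lebesgue. ?v x)"
      unfolding E(1) using t by (intro le[OF m(1) min_u_le[OF f nonneg] u_nonneg_abs(1) E(2-4)]) auto
    also have "\<dots> \<le> Sup (?S ?v)" by (rule cSup_upper[OF top bdd])
    finally show "z \<le> Sup (?S ?v)" .
  qed
qed

end


section \<open>Injectivity of the solution operator\<close>

text \<open>Equal tails mean that the two densities define the same Borel measure, and densities are
  unique almost everywhere. Borel representatives replace \<open>g\<close> and \<open>h\<close>
  because the measures live on \<open>lborel\<close>.\<close>

lemma AE_eq_if_tail_integrals_eq:
  fixes g h :: "real \<Rightarrow> real"
  assumes int: "integrable lebesgue g" "integrable lebesgue h"
    and nn: "AE x in lebesgue. 0 \<le> g x" "AE x in lebesgue. 0 \<le> h x"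
    and tail: "\<And>x. (\<integral>y. indicator {x<..} y * g y \<partial>lebesgue) = (\<integral>y. indicator {x<..} y * h y \<partial>lebesgue)"
  shows "AE x in lebesgue. g x = h x"
proof -
  have dens: "emeasure (density lborel (\<lambda>y. ennreal (k' y))) {x<..} = ennreal (\<integral>y. indicator {x<..} y * k y \<partial>lebesgue)"
    if k: "integrable lebesgue k" "AE x in lebesgue. 0 \<le> k x"
      and k': "k' \<in> borel_measurable lborel" "AE x in lborel. k x = k' x" for k k' :: "real \<Rightarrow> real" and x
  proof -
    have ix: "integrable lebesgue (\<lambda>y. indicator {x<..} y * k y)"
      using integrable_mult_indicator[OF _ k(1), of "{x<..}"] by simp
    have "emeasure (density lborel (\<lambda>y. ennreal (k' y))) {x<..} = (\<integral>\<^sup>+y. ennreal (k' y) * indicator {x<..} y \<partial>lborel)"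
      using k'(1) by (intro emeasure_density) auto
    also have "\<dots> = (\<integral>\<^sup>+y. ennreal (indicator {x<..} y * k y) \<partial>lborel)"
      by (rule nn_integral_cong_AE, use k'(2) in eventually_elim) (auto simp: indicator_def)
    also have "\<dots> = (\<integral>\<^sup>+y. ennreal (indicator {x<..} y * k y) \<partial>lebesgue)"
      by (simp add: nn_integral_completion)
    also have "\<dots> = ennreal (\<integral>y. indicator {x<..} y * k y \<partial>lebesgue)"
      by (rule nn_integral_eq_integral[OF ix], use k(2) in eventually_elim) (auto simp: indicator_def)
    finally show ?thesis .
  qed
  obtain g' where g': "g' \<in> borel_measurable lborel" "AE x in lborel. g x = g' x"
    using completion_ex_borel_measurable_real[OF borel_measurable_integrable[OF int(1)]] by blast
  obtain h' where h': "h' \<in> borel_measurable lborel" "AE x in lborel. h x = h' x"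
    using completion_ex_borel_measurable_real[OF borel_measurable_integrable[OF int(2)]] by blast
  have "density lborel (\<lambda>y. ennreal (g' y)) = density lborel (\<lambda>y. ennreal (h' y))"
    by (rule measure_eqI_lessThan) (simp_all add: dens[OF int(1) nn(1) g'] dens[OF int(2) nn(2) h'] tail)
  then have "AE x in lborel. ennreal (g' x) = ennreal (h' x)"
    by (subst (asm) sigma_finite_measure.density_unique_iff[OF lborel.sigma_finite_measure_axioms]) (use g'(1) h'(1) in auto)
  with g'(2) h'(2) nn(1)[unfolded AE_completion_iff] nn(2)[unfolded AE_completion_iff]
  have "AE x in lborel. g x = h x" by eventually_elim simp
  then show ?thesis by (rule AE_completion)
qed

text \<open>The weight is the derivative of \<open>G\<close> in its first argument.\<close>
lemma u_zero_imp_derivative_zero: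
  assumes d: "set_integrable lebesgue {-pi..pi} d"
    and zero: "\<And>x. x \<in> {-pi..pi} \<Longrightarrow> u d x = 0" and x: "x \<in> {-pi..pi}"
  shows "(LINT y:{-pi..pi}|lebesgue. (- y / (2 * pi) + (if y \<le> x then - 1 / 2 else 1 / 2)) * d y) = 0"
proof -
  \<comment> \<open>The increments point towards an end point different from \<open>x\<close>: they
    never vanish, and \<open>x + h n\<close> stays in the interval where \<open>u d\<close> is
    0.\<close>
  define c where "c = (if x \<le> 0 then pi else - pi)"
  define h where "h n = (c - x) / real (Suc n)" for n
  have cx: "c \<noteq> x" using x pi_gt_zero unfolding c_def by (auto simp del: pi_gt_zero)
  have h0: "h n \<noteq> 0" for n using cx by (simp add: h_def)
  have hlim: "h \<longlonglongrightarrow> 0" unfolding h_def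
    by (rule LIMSEQ_Suc[OF lim_const_over_n])
  have hin: "x + h n \<in> {-pi..pi}" for n
  proof -
    have "h n = (c - x) * (1 / real (Suc n))" by (simp add: h_def)
    moreover have "0 \<le> 1 / real (Suc n)" "1 / real (Suc n) \<le> 1" by auto
    moreover have "\<bar>c\<bar> \<le> pi" by (simp add: c_def)
    ultimately show ?thesis using x
      by (smt (verit) atLeastAtMost_iff mult_left_le mult_nonneg_nonneg mult_nonpos_nonneg mult_le_cancel_left1)
  qed
  let ?Q = "\<lambda>y. - y / (2 * pi) + (if y \<le> x then - 1 / 2 else 1 / 2)"
  let ?s = "\<lambda>n y. indicator {-pi..pi} y *\<^sub>R ((1 / h n) * (G (x + h n) y * d y - G x y * d y))"
  let ?q = "\<lambda>y. indicator {-pi..pi} y *\<^sub>R (?Q y * d y)"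
  have di: "integrable lebesgue (\<lambda>y. indicator {-pi..pi} y *\<^sub>R d y)" using d by (simp add: set_integrable_def)
  have sI: "set_integrable lebesgue {-pi..pi} (\<lambda>y. (1 / h n) * (G (x + h n) y * d y - G x y * d y))" for n
    by (intro set_integrable_mult_right set_integral_diff(1) G_mult_integrable d)
  have s0: "integral\<^sup>L lebesgue (?s n) = 0" for n
  proof -
    have "integral\<^sup>L lebesgue (?s n) = (1 / h n) * (u d (x + h n) - u d x)"
      unfolding u_def set_integral_diff(2)[OF G_mult_integrable[OF d] G_mult_integrable[OF d], symmetric]
      by (simp add: set_lebesgue_integral_def)
    then show ?thesis using zero[OF x] zero[OF hin[of n]] by simp
  qed
  have "(\<lambda>n. integral\<^sup>L lebesgue (?s n)) \<longlonglongrightarrow> integral\<^sup>L lebesgue ?q"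
  proof (rule integral_dominated_convergence)
    have [measurable]: "(\<lambda>y. indicator {-pi..pi} y * d y) \<in> borel_measurable lebesgue" using di by simp
    have "?Q \<in> borel_measurable borel" by measurable
    then have [measurable]: "?Q \<in> borel_measurable lebesgue" by (intro measurable_completion) simp
    have "(\<lambda>y. ?Q y * (indicator {-pi..pi} y * d y)) \<in> borel_measurable lebesgue" by measurable
    then show "?q \<in> borel_measurable lebesgue" by (simp add: mult.left_commute)
    show "?s n \<in> borel_measurable lebesgue" for n
      using sI[of n] unfolding set_integrable_def by (rule borel_measurable_integrable)
    show "integrable lebesgue (\<lambda>y. norm (indicator {-pi..pi} y *\<^sub>R d y))" by (rule integrable_norm[OF di])
    have bd: "norm (?s n y) \<le> norm (indicator {-pi..pi} y *\<^sub>R d y)" for n y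
    proof (cases "y \<in> {-pi..pi}")
      case True
      then have "\<bar>G (x + h n) y - G x y\<bar> \<le> \<bar>h n\<bar>" using G_diff_le[of y "x + h n" x] by auto
      then have "\<bar>G (x + h n) y - G x y\<bar> / \<bar>h n\<bar> \<le> 1" using h0[of n] by simp
      then have "\<bar>G (x + h n) y - G x y\<bar> / \<bar>h n\<bar> * \<bar>d y\<bar> \<le> 1 * \<bar>d y\<bar>" by (intro mult_right_mono) auto
      then show ?thesis using True by (simp add: left_diff_distrib[symmetric] abs_mult)
    qed simp
    then show "AE y in lebesgue. norm (?s n y) \<le> norm (indicator {-pi..pi} y *\<^sub>R d y)" for n by simp
    \<comment> \<open>Once \<open>\<bar>h n\<bar> < \<bar>x - y\<bar>\<close>, both \<open>x\<close>
      and \<open>x + h n\<close> lie on the same side of \<open>y\<close>, where \<open>G\<close> is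
      affine in its first argument; the quotient then equals its limit.\<close>
    have ptw: "(\<lambda>n. ?s n y) \<longlonglongrightarrow> ?q y" if "y \<noteq> x" for y
    proof (rule tendsto_eventually)
      have "eventually (\<lambda>n. \<bar>h n\<bar> < \<bar>x - y\<bar>) sequentially"
        using order_tendstoD(2)[OF tendsto_rabs[OF hlim], of "\<bar>x - y\<bar>"] that by simp
      then show "eventually (\<lambda>n. ?s n y = ?q y) sequentially"
      proof eventually_elim
        case (elim n)
        have "\<bar>x + h n - y\<bar> - \<bar>x - y\<bar> = (if y \<le> x then h n else - h n)"
          using elim that by (auto simp: abs_if split: if_splits)
        moreover have "G (x + h n) y - G x y = - h n * y / (2 * pi) - (\<bar>x + h n - y\<bar> - \<bar>x - y\<bar>) / 2"
          by (simp add: G_def algebra_simps add_divide_distrib diff_divide_distrib)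
        ultimately have "G (x + h n) y - G x y = h n * ?Q y" by (auto simp: algebra_simps)
        then have "(1 / h n) * (G (x + h n) y * d y - G x y * d y) = ?Q y * d y"
          using h0[of n] by (simp add: left_diff_distrib[symmetric])
        then show ?case by presburger
      qed
    qed
    have "AE y in lebesgue. y \<noteq> x" by (intro AE_completion AE_lborel_singleton)
    then show "AE y in lebesgue. (\<lambda>n. ?s n y) \<longlonglongrightarrow> ?q y" by eventually_elim (rule ptw)
  qed
  then have "(\<lambda>n. 0) \<longlonglongrightarrow> integral\<^sup>L lebesgue ?q" unfolding s0 .
  then have "integral\<^sup>L lebesgue ?q = 0" by (rule LIMSEQ_unique) (rule tendsto_const)
  then show ?thesis by (simp only: set_lebesgue_integral_def)
qed

text \<open>Subtracting the derivative identity at \<open>pi\<close> from that at \<open>x\<close>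
  removes \<open>- y / (2 * pi)\<close> and leaves the integral of \<open>g - h\<close> over
  \<open>{x<..pi}\<close>. One derivative suffices, since functions with equal tail integrals agree
  almost everywhere.\<close>

lemma u_inject:
  assumes g: "set_integrable lebesgue {-pi..pi} g" "AE x in lebesgue. x \<in> {-pi..pi} \<longrightarrow> 0 \<le> g x"
    and h: "set_integrable lebesgue {-pi..pi} h" "AE x in lebesgue. x \<in> {-pi..pi} \<longrightarrow> 0 \<le> h x"
    and eq: "\<And>x. x \<in> {-pi..pi} \<Longrightarrow> u g x = u h x"
  shows "AE x in lebesgue. x \<in> {-pi..pi} \<longrightarrow> g x = h x"
proof -
  define d where "d y = g y - h y" for y
  have d: "set_integrable lebesgue {-pi..pi} d" unfolding d_def by (rule set_integral_diff(1)[OF g(1) h(1)])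
  have ud: "u d x = 0" if "x \<in> {-pi..pi}" for x
  proof -
    have "u d x = u g x - u h x" unfolding u_def d_def right_diff_distrib
      by (rule set_integral_diff(2)[OF G_mult_integrable[OF g(1)] G_mult_integrable[OF h(1)]])
    then show ?thesis using eq[OF that] by simp
  qed
  let ?Q = "\<lambda>x y. - y / (2 * pi) + (if y \<le> x then - 1 / 2 else 1 / 2)"
  have di: "integrable lebesgue (\<lambda>y. indicator {-pi..pi} y *\<^sub>R d y)" using d by (simp add: set_integrable_def)
  have Qi: "set_integrable lebesgue {-pi..pi} (\<lambda>y. ?Q x y * d y)" for x
    unfolding set_integrable_def
  proof (rule Bochner_Integration.integrable_bound[OF di])
    have [measurable]: "(\<lambda>y. indicator {-pi..pi} y * d y) \<in> borel_measurable lebesgue" using di by simp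
    have "?Q x \<in> borel_measurable borel" by measurable
    then have [measurable]: "?Q x \<in> borel_measurable lebesgue" by (intro measurable_completion) simp
    have "(\<lambda>y. ?Q x y * (indicator {-pi..pi} y * d y)) \<in> borel_measurable lebesgue" by measurable
    then show "(\<lambda>y. indicator {-pi..pi} y *\<^sub>R (?Q x y * d y)) \<in> borel_measurable lebesgue" by (simp add: mult.left_commute)
    have "norm (indicator {-pi..pi} y *\<^sub>R (?Q x y * d y)) \<le> norm (indicator {-pi..pi} y *\<^sub>R d y)" for y
    proof (cases "y \<in> {-pi..pi}")
      case True
      then have "\<bar>- y / (2 * pi)\<bar> \<le> 1 / 2" by (auto simp: field_simps)
      moreover have "\<bar>if y \<le> x then - 1 / 2 else 1 / 2\<bar> \<le> (1 / 2 :: real)" by simp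
      ultimately have "\<bar>?Q x y\<bar> \<le> 1"
        using abs_triangle_ineq[of "- y / (2 * pi)" "if y \<le> x then - 1 / 2 else 1 / 2"] by linarith
      then have "\<bar>?Q x y\<bar> * \<bar>d y\<bar> \<le> 1 * \<bar>d y\<bar>" by (intro mult_right_mono) auto
      then show ?thesis using True by (simp add: abs_mult)
    qed simp
    then show "AE y in lebesgue. norm (indicator {-pi..pi} y *\<^sub>R (?Q x y * d y)) \<le> norm (indicator {-pi..pi} y *\<^sub>R d y)"
      by simp
  qed
  have tail0: "(\<integral>y. indicator {x<..} y * (indicator {-pi..pi} y * d y) \<partial>lebesgue) = 0" for x
  proof -
    have inside: "(\<integral>y. indicator {x<..} y * (indicator {-pi..pi} y * d y) \<partial>lebesgue) = 0" if x: "x \<in> {-pi..pi}" for x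
    proof -
      have "(\<integral>y. indicator {x<..} y * (indicator {-pi..pi} y * d y) \<partial>lebesgue)
          = (LINT y:{-pi..pi}|lebesgue. ?Q x y * d y - ?Q pi y * d y)"
        unfolding set_lebesgue_integral_def
        by (intro Bochner_Integration.integral_cong) (auto simp: indicator_def algebra_simps)
      also have "\<dots> = 0"
        using u_zero_imp_derivative_zero[OF d ud x] u_zero_imp_derivative_zero[OF d ud, of pi]
        by (subst set_integral_diff(2)[OF Qi Qi]) simp
      finally show ?thesis .
    qed
    consider "x \<in> {-pi..pi}" | "pi < x" | "x < -pi" by fastforce
    then show ?thesis
    proof cases
      case 2
      then have "(\<lambda>y. indicator {x<..} y * (indicator {-pi..pi} y * d y)) = (\<lambda>y. 0)"
        by (auto simp: indicator_def)
      then show ?thesis by simp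
    next
      \<comment> \<open>The tails from \<open>x\<close> and from \<open>-pi\<close> differ only in
        the point \<open>-pi\<close>.\<close>
      case 3
      have "(\<integral>y. indicator {x<..} y * (indicator {-pi..pi} y * d y) \<partial>lebesgue)
         = (\<integral>y. indicator {-pi<..} y * (indicator {-pi..pi} y * d y) \<partial>lebesgue)"
      proof (rule integral_cong_AE)
        have [measurable]: "(\<lambda>y. indicator {-pi..pi} y * d y) \<in> borel_measurable lebesgue" using di by simp
        have [measurable]: "{z<..} \<in> sets lebesgue" for z :: real by simp
        show "(\<lambda>y. indicator {x<..} y * (indicator {-pi..pi} y * d y)) \<in> borel_measurable lebesgue"
          "(\<lambda>y. indicator {-pi<..} y * (indicator {-pi..pi} y * d y)) \<in> borel_measurable lebesgue"
          by measurable
        show "AE y in lebesgue. indicator {x<..} y * (indicator {-pi..pi} y * d y)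
            = indicator {-pi<..} y * (indicator {-pi..pi} y * d y)"
          using AE_interior by eventually_elim (use 3 in \<open>auto simp: indicator_def\<close>)
      qed
      also have "\<dots> = 0" by (rule inside) simp
      finally show ?thesis .
    qed (rule inside)
  qed
  have gi: "integrable lebesgue (\<lambda>y. indicator {-pi..pi} y * g y)" and hi: "integrable lebesgue (\<lambda>y. indicator {-pi..pi} y * h y)"
    using g(1) h(1) by (simp_all add: set_integrable_def)
  have "AE x in lebesgue. indicator {-pi..pi} x * g x = indicator {-pi..pi} x * h x"
  proof (rule AE_eq_if_tail_integrals_eq[OF gi hi])
    show "AE x in lebesgue. 0 \<le> indicator {-pi..pi} x * g x" "AE x in lebesgue. 0 \<le> indicator {-pi..pi} x * h x"
      using g(2) h(2) by (eventually_elim, simp add: indicator_def)+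
    fix x :: real
    have i: "integrable lebesgue (\<lambda>y. indicator {x<..} y * (indicator {-pi..pi} y * g y))"
      "integrable lebesgue (\<lambda>y. indicator {x<..} y * (indicator {-pi..pi} y * h y))"
      using integrable_mult_indicator[OF _ gi, of "{x<..}"] integrable_mult_indicator[OF _ hi, of "{x<..}"] by simp_all
    have "(\<integral>y. indicator {x<..} y * (indicator {-pi..pi} y * g y) \<partial>lebesgue)
        - (\<integral>y. indicator {x<..} y * (indicator {-pi..pi} y * h y) \<partial>lebesgue)
        = (\<integral>y. indicator {x<..} y * (indicator {-pi..pi} y * d y) \<partial>lebesgue)"
      by (subst Bochner_Integration.integral_diff[OF i, symmetric]) (simp add: d_def algebra_simps)
    then show "(\<integral>y. indicator {x<..} y * (indicator {-pi..pi} y * g y) \<partial>lebesgue)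
        = (\<integral>y. indicator {x<..} y * (indicator {-pi..pi} y * h y) \<partial>lebesgue)"
      using tail0[of x] by simp
  qed
  then show ?thesis by eventually_elim (auto simp: indicator_def)
qed


section \<open>The equality case\<close>

context
  fixes f :: "real \<Rightarrow> real"
  assumes f: "set_integrable lebesgue {-pi..pi} f"
    and nonneg: "AE x in lebesgue. x \<in> {-pi..pi} \<longrightarrow> 0 \<le> f x"
begin

text \<open>The kernel is positive inside the square, so a zero would force
  \<open>sym_rearr f\<close> to vanish almost everywhere, and then \<open>f\<close>, whose integral
  is the same.\<close>

lemma u_sym_rearr_pos:
  assumes nz: "\<not> (AE x in lebesgue. x \<in> {-pi..pi} \<longrightarrow> f x = 0)" and x: "\<bar>x\<bar> < pi"
  shows "0 < u (sym_rearr f) x"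
proof (rule ccontr)
  assume "\<not> ?thesis"
  then have "u (sym_rearr f) x = 0" using u_nonneg_abs(2)[OF f nonneg, of x] x by simp
  then have "AE y in lebesgue. indicator {-pi..pi} y *\<^sub>R (G x y * sym_rearr f y) = 0"
    unfolding u_def set_lebesgue_integral_def
  proof (subst (asm) integral_nonneg_eq_0_iff_AE)
    show "integrable lebesgue (\<lambda>y. indicator {-pi..pi} y *\<^sub>R (G x y * sym_rearr f y))"
      using G_mult_integrable[OF sym_rearr_facts(1)[OF f nonneg]] by (simp add: set_integrable_def)
    show "AE y in lebesgue. 0 \<le> indicator {-pi..pi} y *\<^sub>R (G x y * sym_rearr f y)"
      using AE_sym_rearr_nonneg[OF f nonneg]
      by eventually_elim (use x in \<open>auto simp: indicator_def G_nonneg\<close>)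
  qed
  then have "AE y in lebesgue. indicator {-pi..pi} y * ennreal (sym_rearr f y) = 0"
    using AE_interior
  proof eventually_elim
    case (elim y)
    show ?case
    proof (cases "y \<in> {-pi..pi}")
      case True
      then have "0 < G x y" using elim x by (intro G_pos) auto
      then show ?thesis using elim(1) True by simp
    qed simp
  qed
  then have "(\<integral>\<^sup>+y. indicator {-pi..pi} y * ennreal (sym_rearr f y) \<partial>lebesgue) = integral\<^sup>N lebesgue (\<lambda>y::real. 0)"
    by (rule nn_integral_cong_AE)
  then have "(\<integral>\<^sup>+y. indicator {-pi..pi} y * ennreal (f y) \<partial>lebesgue) = 0"
    unfolding nn_integral_sym_rearr_eq[OF f nonneg] by simp
  moreover have "(\<integral>\<^sup>+y. indicator {-pi..pi} y * ennreal (f y) \<partial>lebesgue)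
      = (\<integral>\<^sup>+y. ennreal (indicator {-pi..pi} y *\<^sub>R f y) \<partial>lebesgue)"
    by (intro nn_integral_cong) (auto simp: indicator_def)
  ultimately have "(\<integral>\<^sup>+y. ennreal (indicator {-pi..pi} y *\<^sub>R f y) \<partial>lebesgue) = 0" by metis
  moreover have "(\<lambda>y. ennreal (indicator {-pi..pi} y *\<^sub>R f y)) \<in> borel_measurable lebesgue"
    using borel_measurable_integrable[OF f[unfolded set_integrable_def]] by (rule measurable_compose) simp
  ultimately have "AE y in lebesgue. ennreal (indicator {-pi..pi} y *\<^sub>R f y) = 0"
    by (simp only: nn_integral_0_iff_AE)
  then have "AE y in lebesgue. y \<in> {-pi..pi} \<longrightarrow> f y = 0"
    using nonneg by eventually_elim (auto simp: indicator_def ennreal_eq_0_iff)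
  with nz show False by blast
qed

text \<open>The least function that dominates \<open>u f\<close> in the sense of \<open>integral_mono_comp_le\<close>; it is the
  symmetric decreasing rearrangement of \<open>u f\<close>. The truncation at \<open>pi\<close> keeps the supremum over a
  nonempty set.\<close>
definition u_rearr :: "real \<Rightarrow> real" where
  "u_rearr x = Sup ((\<lambda>(a, b). min (u f a) (u f b)) `
     {(a, b) \<in> {-pi..pi} \<times> {-pi..pi}. 2 * min \<bar>x\<bar> pi \<le> b - a})"

text \<open>A continuous function on a compact set of pairs. The maximising pair is the one at which
  the pointwise inequality is tested for equality.\<close>

lemma u_rearr_attained:
  obtains a b where "-pi \<le> a" "a \<le> b" "b \<le> pi" "2 * min \<bar>x\<bar> pi \<le> b - a"
    "u_rearr x = min (u f a) (u f b)"
    "\<And>a' b'. \<lbrakk>-pi \<le> a'; b' \<le> pi; 2 * min \<bar>x\<bar> pi \<le> b' - a'\<rbrakk> \<Longrightarrow> min (u f a') (u f b') \<le> u_rearr x"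
proof -
  define C where "C = {(a, b) \<in> {-pi..pi} \<times> {-pi..pi}. 2 * min \<bar>x\<bar> pi \<le> b - a}"
  define m where "m = (\<lambda>(a, b). min (u f a) (u f b))"
  have C: "C = ({-pi..pi} \<times> {-pi..pi}) \<inter> {z. 2 * min \<bar>x\<bar> pi \<le> snd z - fst z}"
    by (auto simp: C_def)
  have "compact C" unfolding C
    by (intro compact_Int_closed compact_Times compact_Icc closed_Collect_le continuous_intros)
  moreover have "(-pi, pi) \<in> C" by (auto simp: C_def)
  then have "C \<noteq> {}" by blast
  moreover have "continuous_on C m" unfolding m_def case_prod_beta
    by (intro continuous_intros continuous_on_compose2[OF continuous_on_u[OF f, of UNIV]]) auto
  ultimately obtain z where z: "z \<in> C" "\<And>z'. z' \<in> C \<Longrightarrow> m z' \<le> m z"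
    using continuous_attains_sup[of C m] by blast
  have sup: "u_rearr x = m z"
    unfolding u_rearr_def C_def[symmetric] m_def[symmetric]
    by (rule cSup_eq_maximum) (use z in auto)
  obtain a b where ab: "z = (a, b)" by (cases z)
  show ?thesis
  proof (rule that[of a b])
    show "-pi \<le> a" "b \<le> pi" "2 * min \<bar>x\<bar> pi \<le> b - a" using z(1) by (auto simp: ab C_def)
    then show "a \<le> b" using pi_gt_zero by linarith
    show "u_rearr x = min (u f a) (u f b)" using sup by (simp add: ab m_def)
    fix a' b' assume *: "-pi \<le> a'" "b' \<le> pi" "2 * min \<bar>x\<bar> pi \<le> b' - a'"
    then have "a' \<le> b'" using pi_gt_zero by linarith
    with * have "(a', b') \<in> C" by (auto simp: C_def)
    then show "min (u f a') (u f b') \<le> u_rearr x" unfolding sup using z(2) by (force simp: m_def)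
  qed
qed

lemma u_rearr_antimono: "\<bar>x\<bar> \<le> \<bar>y\<bar> \<Longrightarrow> u_rearr y \<le> u_rearr x"
proof -
  assume xy: "\<bar>x\<bar> \<le> \<bar>y\<bar>"
  obtain a b where ab: "-pi \<le> a" "a \<le> b" "b \<le> pi" "2 * min \<bar>y\<bar> pi \<le> b - a" "u_rearr y = min (u f a) (u f b)"
    by (rule u_rearr_attained)
  have "2 * min \<bar>x\<bar> pi \<le> b - a" using ab(4) xy by (auto simp: min_def split: if_splits)
  then show ?thesis unfolding ab(5) using ab by (metis u_rearr_attained)
qed

lemma u_rearr_measurable: "u_rearr \<in> borel_measurable borel"
proof -
  \<comment> \<open>Freezing the argument at 0 for negative \<open>r\<close> makes the profile
    monotone on the whole line; composing with the absolute value recovers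
    \<open>u_rearr\<close>.\<close>
  have "mono (\<lambda>r. - u_rearr (max 0 r))" using u_rearr_antimono by (auto intro!: monoI)
  then have "(\<lambda>r. - u_rearr (max 0 r)) \<in> borel_measurable borel" by (rule borel_measurable_mono)
  then have [measurable]: "(\<lambda>r. u_rearr (max 0 r)) \<in> borel_measurable borel" by simp
  have "(\<lambda>x. u_rearr (max 0 \<bar>x\<bar>)) \<in> borel_measurable borel"
    by (rule measurable_compose[of abs]) measurable
  moreover have "u_rearr (max 0 \<bar>x\<bar>) = u_rearr x" for x by (simp add: u_rearr_def)
  ultimately show ?thesis by simp
qed

lemma u_rearr_bounds:
  assumes x: "\<bar>x\<bar> \<le> pi"
  shows "0 \<le> u_rearr x" "u_rearr x \<le> u (sym_rearr f) x"
proof -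
  obtain a b where ab: "-pi \<le> a" "a \<le> b" "b \<le> pi" "2 * min \<bar>x\<bar> pi \<le> b - a" "u_rearr x = min (u f a) (u f b)"
    by (rule u_rearr_attained)
  show "0 \<le> u_rearr x" unfolding ab(5) using u_nonneg_abs(1)[OF f nonneg] ab by (auto simp: abs_le_iff)
  have "u_rearr x \<le> u (sym_rearr f) ((b - a) / 2)" unfolding ab(5) by (rule min_u_le[OF f nonneg ab(1-3)])
  also have "\<dots> \<le> u (sym_rearr f) x"
    using ab x by (intro u_sym_rearr_antimono[OF f nonneg]) auto
  finally show "u_rearr x \<le> u (sym_rearr f) x" .
qed

lemma min_u_le_u_rearr:
  assumes "-pi \<le> a" "a \<le> b" "b \<le> pi"
  shows "min (u f a) (u f b) \<le> u_rearr ((b - a) / 2)"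
proof -
  have "2 * min \<bar>(b - a) / 2\<bar> pi \<le> b - a" using assms by (simp add: min_def)
  then show ?thesis using assms by (metis u_rearr_attained)
qed

text \<open>At a maximising pair,
  \<open>v x \<le> \<kappa> * v ((b - a) / 2) \<le> \<kappa> * v x\<close> with
  \<open>v x > 0\<close>, so \<open>\<kappa> = 1\<close> and \<open>a = - b\<close>. Concavity then
  gives \<open>u f \<ge> v x\<close> at both \<open>x\<close> and \<open>- x\<close>, while the
  weighted inequality for this symmetric pair, with factor 1, bounds the sum of the two values by
  \<open>2 * v x\<close>.\<close>

lemma u_eq_if_u_rearr_eq:
  assumes nz: "\<not> (AE x in lebesgue. x \<in> {-pi..pi} \<longrightarrow> f x = 0)" and x: "\<bar>x\<bar> < pi"
    and eq: "u_rearr x = u (sym_rearr f) x"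
  shows "u f x = u (sym_rearr f) x"
proof -
  let ?v = "u (sym_rearr f)"
  have pos: "0 < ?v x" by (rule u_sym_rearr_pos[OF nz x])
  obtain a b where ab: "-pi \<le> a" "a \<le> b" "b \<le> pi" "2 * min \<bar>x\<bar> pi \<le> b - a" "u_rearr x = min (u f a) (u f b)"
    by (rule u_rearr_attained)
  have xb: "2 * \<bar>x\<bar> \<le> b - a" using ab(4) x by simp
  have sym: "a = - b"
  proof (cases "b - a < 2 * pi")
    case True
    define \<kappa> where "\<kappa> = 4 * (pi + a) * (pi - b) / (pi + a + (pi - b))\<^sup>2"
    have pq: "0 < pi + a + (pi - b)" using True by simp
    have \<kappa>: "\<kappa> \<le> 1" "\<kappa> = 1 \<Longrightarrow> pi + a = pi - b" "0 \<le> \<kappa>"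
      using four_mult_div_sum_squared[OF pq] ab unfolding \<kappa>_def by (blast, blast, simp)
    have "?v x \<le> \<kappa> * ?v ((b - a) / 2)"
      unfolding eq[symmetric] ab(5) \<kappa>_def by (rule min_u_le_weighted[OF f nonneg ab(1-3) True])
    also have "\<dots> \<le> \<kappa> * ?v x"
      using xb \<kappa> by (intro mult_left_mono u_sym_rearr_antimono[OF f nonneg]) auto
    finally have "1 \<le> \<kappa>" using pos by simp
    then show ?thesis using \<kappa> by simp
  next
    case False
    then show ?thesis using ab by simp
  qed
  have low: "?v x \<le> u f z" if "\<bar>z\<bar> \<le> \<bar>x\<bar>" for z
    unfolding eq[symmetric] ab(5) sym
    by (rule u_ge_min_between[OF f nonneg]) (use xb that sym in auto)
  define r where "r = \<bar>x\<bar>"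
  have r: "-pi \<le> -r" "-r \<le> r" "r \<le> pi" "r - (-r) < 2 * pi" "0 < pi - r" using x by (auto simp: r_def)
  have vr: "?v r = ?v x" using u_sym_rearr_even[OF f nonneg, of x] by (simp add: r_def abs_if)
  have scale: "4 * s * s / (s + s)\<^sup>2 = 1" "(s * A + s * B) / (s + s) = (A + B) / 2" if "0 < s" for s A B :: real
    using that by (simp_all add: power2_eq_square field_simps)
  have "((pi - r) * u f (- r) + (pi - r) * u f r) / ((pi - r) + (pi - r))
      \<le> 4 * (pi - r) * (pi - r) / ((pi - r) + (pi - r))\<^sup>2 * ?v r"
    using u_weighted_le[OF f nonneg r(1-4)] by simp
  also have "4 * (pi - r) * (pi - r) / ((pi - r) + (pi - r))\<^sup>2 = 1"
    using scale(1)[OF r(5)] .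
  also have "((pi - r) * u f (- r) + (pi - r) * u f r) / ((pi - r) + (pi - r)) = (u f (- r) + u f r) / 2"
    using scale(2)[OF r(5)] .
  finally have "u f (- r) + u f r \<le> 2 * ?v x" by (simp add: vr)
  moreover have "?v x \<le> u f (- r)" "?v x \<le> u f r" by (auto intro!: low simp: r_def)
  ultimately have "u f r = ?v x" "u f (- r) = ?v x" by auto
  then show ?thesis by (cases "0 \<le> x") (auto simp: r_def)
qed

text \<open>The integral for \<open>u_rearr\<close> lies between the two given ones, so the
  nonnegative difference \<open>\<phi> (v x) - \<phi> (u_rearr x)\<close> integrates to 0. Strict
  monotonicity removes \<open>\<phi>\<close>, which leads to \<open>u f = v\<close> and, by
  injectivity of the solution operator, to the claim.\<close>

lemma AE_eq_sym_rearr_if_integral_eq: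
  fixes \<phi> :: "real \<Rightarrow> real"
  assumes nz: "\<not> (AE x in lebesgue. x \<in> {-pi..pi} \<longrightarrow> f x = 0)" and \<phi>: "strict_mono \<phi>"
    and eq: "(LINT x:{-pi..pi}|lebesgue. \<phi> (u f x)) = (LINT x:{-pi..pi}|lebesgue. \<phi> (u (sym_rearr f) x))"
  shows "AE x in lebesgue. x \<in> {-pi..pi} \<longrightarrow> f x = sym_rearr f x"
proof -
  let ?v = "u (sym_rearr f)"
  have mono: "mono \<phi>" by (rule strict_mono_mono[OF \<phi>])
  have v_le: "?v x \<le> ?v 0" for x using u_sym_rearr_antimono[OF f nonneg, of 0 x] by simp
  have iv: "set_integrable lebesgue {-pi..pi} (\<lambda>x. \<phi> (?v x))"
    by (rule mono_comp_integrable[OF mono u_measurable[OF sym_rearr_facts(1)[OF f nonneg]], where C="?v 0"])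
      (use u_nonneg_abs(2)[OF f nonneg] v_le in auto)
  have iw: "set_integrable lebesgue {-pi..pi} (\<lambda>x. \<phi> (u_rearr x))"
    by (rule mono_comp_integrable[OF mono u_rearr_measurable, where C="?v 0"])
      (use u_rearr_bounds v_le in \<open>auto intro: order.trans\<close>)
  have "(LINT x:{-pi..pi}|lebesgue. \<phi> (u f x)) \<le> (LINT x:{-pi..pi}|lebesgue. \<phi> (u_rearr x))"
    by (rule integral_mono_comp_le[OF mono u_measurable[OF f] u_rearr_measurable])
      (use min_u_le_u_rearr u_rearr_antimono u_nonneg_abs(1)[OF f nonneg] u_rearr_bounds in auto)
  then have le0: "(LINT x:{-pi..pi}|lebesgue. \<phi> (?v x) - \<phi> (u_rearr x)) \<le> 0"
    using eq by (subst set_integral_diff(2)[OF iv iw]) simp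
  have nn: "0 \<le> indicator {-pi..pi} x *\<^sub>R (\<phi> (?v x) - \<phi> (u_rearr x))" for x
    using monoD[OF mono u_rearr_bounds(2)[of x]] by (auto simp: indicator_def)
  have "0 \<le> (LINT x:{-pi..pi}|lebesgue. \<phi> (?v x) - \<phi> (u_rearr x))"
    unfolding set_lebesgue_integral_def by (intro Bochner_Integration.integral_nonneg nn)
  then have int0: "(\<integral>x. indicator {-pi..pi} x *\<^sub>R (\<phi> (?v x) - \<phi> (u_rearr x)) \<partial>lebesgue) = 0"
    using le0 unfolding set_lebesgue_integral_def by (rule antisym[rotated])
  have "AE x in lebesgue. indicator {-pi..pi} x *\<^sub>R (\<phi> (?v x) - \<phi> (u_rearr x)) = 0"
    using int0 by (subst (asm) integral_nonneg_eq_0_iff_AE)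
      (use set_integral_diff(1)[OF iv iw] nn in \<open>auto simp: set_integrable_def\<close>)
  then have AE: "AE x in lebesgue. \<bar>x\<bar> < pi \<longrightarrow> u f x = ?v x"
  proof eventually_elim
    case (elim x)
    show ?case
    proof
      assume x: "\<bar>x\<bar> < pi"
      then have "x \<in> {-pi..pi}" by auto
      then have "\<phi> (u_rearr x) = \<phi> (?v x)" using elim by simp
      then have "u_rearr x = ?v x" using \<phi> by (simp add: strict_mono_eq)
      then show "u f x = ?v x" by (rule u_eq_if_u_rearr_eq[OF nz x])
    qed
  qed
  \<comment> \<open>Both functions are continuous, so a point of disagreement would bring an
    interval of positive length with it.\<close>
  have interior: "u f x = ?v x" if x: "\<bar>x\<bar> < pi" for x
  proof (rule ccontr)
    assume ne: "u f x \<noteq> ?v x"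
    have "open {y. u f y \<noteq> ?v y}"
      by (intro open_Collect_neq continuous_on_u f sym_rearr_facts(1)[OF f nonneg])
    then have "open ({y. u f y \<noteq> ?v y} \<inter> {-pi<..<pi})" by (rule open_Int) simp
    moreover have "x \<in> {y. u f y \<noteq> ?v y} \<inter> {-pi<..<pi}" using ne x by auto
    ultimately obtain e where e: "0 < e" "ball x e \<subseteq> {y. u f y \<noteq> ?v y} \<inter> {-pi<..<pi}"
      using openE by blast
    have "AE y in lebesgue. y \<notin> {x - e<..<x + e}"
      using AE
    proof eventually_elim
      case (elim y)
      show ?case
      proof
        assume "y \<in> {x - e<..<x + e}"
        then have "y \<in> ball x e" by (auto simp: dist_real_def)
        then have "y \<in> {y. u f y \<noteq> ?v y} \<inter> {-pi<..<pi}" using e(2) by blast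
        then have "u f y \<noteq> ?v y" "\<bar>y\<bar> < pi" by auto
        then show False using elim by blast
      qed
    qed
    then have "{x - e<..<x + e} \<in> null_sets lebesgue"
      by (subst AE_iff_null_sets) simp_all
    then show False using e(1) by (simp add: null_sets_def)
  qed
  have "u f x = ?v x" if "x \<in> {-pi..pi}" for x
  proof -
    have "x = pi \<or> x = - pi \<or> \<bar>x\<bar> < pi" using that unfolding atLeastAtMost_iff by linarith
    then consider "x = pi" | "x = - pi" | "\<bar>x\<bar> < pi" by blast
    then show ?thesis
      by cases (simp_all add: u_boundary[OF f nonneg] u_boundary[OF sym_rearr_facts[OF f nonneg]] interior)
  qed
  then show ?thesis by (rule u_inject[OF f nonneg sym_rearr_facts[OF f nonneg]])
qed

end

theorem theorem5p7:
  fixes f :: "real \<Rightarrow> real"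
  assumes f_int: "set_integrable lebesgue {-pi..pi} f"
    and f_nonneg: "AE x in lebesgue. x \<in> {-pi..pi} \<longrightarrow> 0 \<le> f x"
    and f_nonzero: "\<not> (AE x in lebesgue. x \<in> {-pi..pi} \<longrightarrow> f x = 0)"
  shows "(\<forall>\<phi> :: real \<Rightarrow> real. convex_on UNIV \<phi> \<and> mono \<phi> \<longrightarrow>
            (LINT x:{-pi..pi}|lebesgue. \<phi> (u f x))
              \<le> (LINT x:{-pi..pi}|lebesgue. \<phi> (u (sym_rearr f) x)))
       \<and> (\<forall>t \<in> {0..2*pi}. star_fun (u f) t \<le> star_fun (u (sym_rearr f)) t)
       \<and> (\<forall>\<phi> :: real \<Rightarrow> real. convex_on UNIV \<phi> \<and> strict_mono \<phi> \<longrightarrow>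
            ((LINT x:{-pi..pi}|lebesgue. \<phi> (u f x))
               = (LINT x:{-pi..pi}|lebesgue. \<phi> (u (sym_rearr f) x))
             \<longleftrightarrow> (AE x in lebesgue. x \<in> {-pi<..<pi} \<longrightarrow> f x = sym_rearr f x)))"
proof (intro conjI allI impI ballI)
  fix \<phi> :: "real \<Rightarrow> real"
  assume "convex_on UNIV \<phi> \<and> mono \<phi>"
  then show "(LINT x:{-pi..pi}|lebesgue. \<phi> (u f x)) \<le> (LINT x:{-pi..pi}|lebesgue. \<phi> (u (sym_rearr f) x))"
    by (intro integral_comp_u_le[OF f_int f_nonneg]) simp
next
  fix t assume "t \<in> {0..2 * pi}"
  then show "star_fun (u f) t \<le> star_fun (u (sym_rearr f)) t" by (rule star_fun_u_le[OF f_int f_nonneg])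
next
  fix \<phi> :: "real \<Rightarrow> real"
  assume \<phi>: "convex_on UNIV \<phi> \<and> strict_mono \<phi>"
  show "(LINT x:{-pi..pi}|lebesgue. \<phi> (u f x)) = (LINT x:{-pi..pi}|lebesgue. \<phi> (u (sym_rearr f) x))
      \<longleftrightarrow> (AE x in lebesgue. x \<in> {-pi<..<pi} \<longrightarrow> f x = sym_rearr f x)"
  proof
    assume "(LINT x:{-pi..pi}|lebesgue. \<phi> (u f x)) = (LINT x:{-pi..pi}|lebesgue. \<phi> (u (sym_rearr f) x))"
    then have "AE x in lebesgue. x \<in> {-pi..pi} \<longrightarrow> f x = sym_rearr f x"
      using \<phi> by (intro AE_eq_sym_rearr_if_integral_eq[OF f_int f_nonneg f_nonzero, of \<phi>]) simp_all
    then show "AE x in lebesgue. x \<in> {-pi<..<pi} \<longrightarrow> f x = sym_rearr f x" by eventually_elim auto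
  next
    assume eq: "AE x in lebesgue. x \<in> {-pi<..<pi} \<longrightarrow> f x = sym_rearr f x"
    \<comment> \<open>The integral defining \<open>u\<close> does not see null sets, so agreement on
      the open interval suffices; \<open>AE_interior\<close> discards the two end points.\<close>
    have "u f x = u (sym_rearr f) x" for x
      unfolding u_def set_lebesgue_integral_def
    proof (rule integral_cong_AE)
      show "(\<lambda>y. indicator {-pi..pi} y *\<^sub>R (G x y * f y)) \<in> borel_measurable lebesgue"
        "(\<lambda>y. indicator {-pi..pi} y *\<^sub>R (G x y * sym_rearr f y)) \<in> borel_measurable lebesgue"
        by (rule borel_measurable_integrable G_mult_integrable[OF f_int, unfolded set_integrable_def]
            G_mult_integrable[OF sym_rearr_integrable[OF f_int f_nonneg], unfolded set_integrable_def])+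
      show "AE y in lebesgue. indicator {-pi..pi} y *\<^sub>R (G x y * f y) = indicator {-pi..pi} y *\<^sub>R (G x y * sym_rearr f y)"
        using eq AE_interior by eventually_elim (auto simp: indicator_def)
    qed
    then show "(LINT x:{-pi..pi}|lebesgue. \<phi> (u f x)) = (LINT x:{-pi..pi}|lebesgue. \<phi> (u (sym_rearr f) x))"
      by simp
  qed
qed

end
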